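(* Let $\alpha,\beta>-1$, let $g\in H(\mathbb{D})$, and let $0<p<q<\infty$. Then $S_g:D_\alpha^p\to D_\beta^q$ is compact if and only if $|g(z)|=o\left((1-|z|^2)^{\frac{2+\alpha}{p}-\frac{2+\beta}{q}}\right)$ as $|z|\to1^-$.
   Context: $\mathbb{D}$ is the open unit disk in $\mathbb{C}$, $H(\mathbb{D})$ is the space of analytic functions on $\mathbb{D}$, and $dA(z)=\frac1\pi\,dx\,dy$ is normalized area measure. For $0<p<\infty$ and $\alpha>-1$, the weighted Dirichlet space $D_\alpha^p$ is the set of $f\in H(\mathbb{D})$ with $\|f\|_{D_\alpha^p}=\left(|f(0)|^p+\int_{\mathbb{D}}|f'(z)|^p(1-|z|^2)^\alpha\,dA(z)\right)^{1/p}<\infty$. (For $p<1$ this is only a quasi-norm.) For $g\in H(\mathbb{D})$, the operator $S_g$ is $(S_gf)(z)=\int_0^z f'(\omega)g(\omega)\,d\omega$, $f\in H(\mathbb{D})$. An operator $T:D_\alpha^p\to D_\beta^q$ is compact if it maps $D_\alpha^p$ into $D_\beta^q$ and sends bounded sets to relatively compact sets. *)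

theory Defs
  imports "HOL-Complex_Analysis.Complex_Analysis" "HOL-Library.Landau_Symbols"
begin

abbreviation unit_disk :: "complex set" where
  "unit_disk \<equiv> ball 0 1"

text \<open>
  A function on the disk is represented by the total function extending it by 0, so that
  equality in HOL is equality on the disk.
\<close>

definition holo_disk :: "(complex \<Rightarrow> complex) set" where
  "holo_disk = {f. f holomorphic_on unit_disk \<and> (\<forall>z. z \<notin> unit_disk \<longrightarrow> f z = 0)}"

definition dirichlet_density :: "real \<Rightarrow> real \<Rightarrow> (complex \<Rightarrow> complex) \<Rightarrow> complex \<Rightarrow> real" where
  "dirichlet_density \<alpha> p f z = norm (deriv f z) powr p * (1 - (norm z)\<^sup>2) powr \<alpha>"

definition dirichlet_space :: "real \<Rightarrow> real \<Rightarrow> (complex \<Rightarrow> complex) set" where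
  "dirichlet_space \<alpha> p =
     {f \<in> holo_disk. set_integrable lborel unit_disk (dirichlet_density \<alpha> p f)}"

text \<open>The factor \<open>1 / pi\<close> normalizes the area measure of the disk to 1.\<close>

definition dirichlet_norm :: "real \<Rightarrow> real \<Rightarrow> (complex \<Rightarrow> complex) \<Rightarrow> real" where
  "dirichlet_norm \<alpha> p f =
     (norm (f 0) powr p
       + 1 / pi * (LINT z:unit_disk|lborel. dirichlet_density \<alpha> p f z)) powr (1 / p)"

text \<open>
  The topology induced by the (quasi-)norm. For \<open>p < 1\<close> the triangle inequality may fail for
  \<^const>\<open>dirichlet_norm\<close>, so \<^locale>\<open>Metric_space\<close> does not apply to the distance it induces.
\<close>

definition dirichlet_open :: "real \<Rightarrow> real \<Rightarrow> (complex \<Rightarrow> complex) set \<Rightarrow> bool" where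
  "dirichlet_open \<alpha> p U \<longleftrightarrow> U \<subseteq> dirichlet_space \<alpha> p \<and>
     (\<forall>f\<in>U. \<exists>e>0. \<forall>h\<in>dirichlet_space \<alpha> p. dirichlet_norm \<alpha> p (\<lambda>z. h z - f z) < e \<longrightarrow> h \<in> U)"

definition dirichlet_topology :: "real \<Rightarrow> real \<Rightarrow> (complex \<Rightarrow> complex) topology" where
  "dirichlet_topology \<alpha> p = topology (dirichlet_open \<alpha> p)"

lemma istopology_dirichlet_open: "istopology (dirichlet_open \<alpha> p)"
  unfolding istopology_def
proof (intro conjI allI impI)
  fix S T assume S: "dirichlet_open \<alpha> p S" and T: "dirichlet_open \<alpha> p T"
  show "dirichlet_open \<alpha> p (S \<inter> T)"
    unfolding dirichlet_open_def
  proof (intro conjI ballI)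
    show "S \<inter> T \<subseteq> dirichlet_space \<alpha> p"
      using S unfolding dirichlet_open_def by (meson le_infI1)
    fix f assume f: "f \<in> S \<inter> T"
    obtain d where d: "d > 0"
      "\<And>h. h \<in> dirichlet_space \<alpha> p \<Longrightarrow> dirichlet_norm \<alpha> p (\<lambda>z. h z - f z) < d \<Longrightarrow> h \<in> S"
      using S f unfolding dirichlet_open_def by (meson IntD1)
    obtain e where e: "e > 0"
      "\<And>h. h \<in> dirichlet_space \<alpha> p \<Longrightarrow> dirichlet_norm \<alpha> p (\<lambda>z. h z - f z) < e \<Longrightarrow> h \<in> T"
      using T f unfolding dirichlet_open_def by (meson IntD2)
    show "\<exists>e>0. \<forall>h\<in>dirichlet_space \<alpha> p.
        dirichlet_norm \<alpha> p (\<lambda>z. h z - f z) < e \<longrightarrow> h \<in> S \<inter> T"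
    proof (intro exI[of _ "min d e"] conjI ballI impI IntI)
      show "min d e > 0" using d(1) e(1) by simp
    qed (use d(2) e(2) in simp_all)
  qed
next
  fix K assume K: "\<forall>S\<in>K. dirichlet_open \<alpha> p S"
  show "dirichlet_open \<alpha> p (\<Union>K)"
    unfolding dirichlet_open_def
  proof (intro conjI ballI)
    show "\<Union>K \<subseteq> dirichlet_space \<alpha> p"
      using K unfolding dirichlet_open_def by (meson Sup_least)
    fix f assume "f \<in> \<Union>K"
    then obtain S where S: "S \<in> K" "f \<in> S" by (rule UnionE)
    then obtain e where "e > 0"
      "\<forall>h\<in>dirichlet_space \<alpha> p. dirichlet_norm \<alpha> p (\<lambda>z. h z - f z) < e \<longrightarrow> h \<in> S"
      using K unfolding dirichlet_open_def by meson
    then show "\<exists>e>0. \<forall>h\<in>dirichlet_space \<alpha> p.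
        dirichlet_norm \<alpha> p (\<lambda>z. h z - f z) < e \<longrightarrow> h \<in> \<Union>K"
      using S(1) by (meson UnionI)
  qed
qed

lemma openin_dirichlet_topology [simp]:
  "openin (dirichlet_topology \<alpha> p) = dirichlet_open \<alpha> p"
  unfolding dirichlet_topology_def
  by (rule topology_inverse'[OF istopology_dirichlet_open])

lemma topspace_dirichlet_topology [simp]:
  "topspace (dirichlet_topology \<alpha> p) = dirichlet_space \<alpha> p"
proof -
  have "dirichlet_open \<alpha> p (dirichlet_space \<alpha> p)"
    unfolding dirichlet_open_def by (auto intro: exI[of _ 1])
  moreover have "S \<subseteq> dirichlet_space \<alpha> p" if "dirichlet_open \<alpha> p S" for S
    using that unfolding dirichlet_open_def by (rule conjunct1)
  ultimately show ?thesis
    unfolding topspace_def openin_dirichlet_topology by (intro equalityI) auto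
qed

definition dirichlet_bounded :: "real \<Rightarrow> real \<Rightarrow> (complex \<Rightarrow> complex) set \<Rightarrow> bool" where
  "dirichlet_bounded \<alpha> p B \<longleftrightarrow>
     B \<subseteq> dirichlet_space \<alpha> p \<and> (\<exists>M. \<forall>f\<in>B. dirichlet_norm \<alpha> p f \<le> M)"

definition relatively_compact_in :: "'a topology \<Rightarrow> 'a set \<Rightarrow> bool" where
  "relatively_compact_in X S \<longleftrightarrow> S \<subseteq> topspace X \<and> compactin X (X closure_of S)"

definition dirichlet_compact_operator ::
  "real \<Rightarrow> real \<Rightarrow> real \<Rightarrow> real \<Rightarrow> ((complex \<Rightarrow> complex) \<Rightarrow> (complex \<Rightarrow> complex)) \<Rightarrow> bool" where
  "dirichlet_compact_operator \<alpha> p \<beta> q T \<longleftrightarrow>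
     T ` dirichlet_space \<alpha> p \<subseteq> dirichlet_space \<beta> q \<and>
     (\<forall>B. dirichlet_bounded \<alpha> p B \<longrightarrow>
        relatively_compact_in (dirichlet_topology \<beta> q) (T ` B))"

definition S_op :: "(complex \<Rightarrow> complex) \<Rightarrow> (complex \<Rightarrow> complex) \<Rightarrow> complex \<Rightarrow> complex" where
  "S_op g f z =
     (if z \<in> unit_disk then contour_integral (linepath 0 z) (\<lambda>w. deriv f w * g w) else 0)"

end

theory Submission
  imports Defs
begin

text \<open>
  Since \<open>(S_g f)' = f' g\<close> and \<open>(S_g f)(0) = 0\<close>, everything is about multiplication by \<open>g\<close> between
  weighted Bergman spaces. The basic estimate is \<open>|F(a)|^p (1 - |a|\<^sup>2)^(\<alpha> + 2) \<le> C \<parallel>F\<parallel>^p\<close>.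

  If \<open>|g| \<le> c (1 - |z|\<^sup>2)^\<gamma>\<close> with \<open>\<gamma> = (2 + \<alpha>)/p - (2 + \<beta>)/q\<close>, apply this estimate to the factor
  \<open>|F|^(q - p)\<close> of \<open>|F g|^q (1 - |z|\<^sup>2)^\<beta>\<close>: all exponents cancel and the product is at most
  \<open>K c^q |F|^p (1 - |z|\<^sup>2)^\<alpha>\<close>. For a bounded sequence, Montel's theorem gives a locally uniform
  limit of the derivatives; the differences are small near the circle because \<open>c\<close> may be taken
  small there, and small on compact subsets by uniform convergence.

  Conversely, test with \<open>F_a(z) = (1 - |a|\<^sup>2)^(N - (2 + \<alpha>)/p) / (1 - cnj a z)^N\<close>, whose norms are
  bounded (substitute a Moebius map). As \<open>|a| \<rightarrow> 1\<close> the functions \<open>F_a\<close> tend to 0 pointwise, so by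
  compactness \<open>F_a g\<close> tends to 0 in norm along a subsequence, and the basic estimate at the point
  \<open>a\<close> forces \<open>|g(a)| (1 - |a|\<^sup>2)^(-\<gamma>) \<rightarrow> 0\<close>.
\<close>

section \<open>Point evaluations on weighted Bergman spaces\<close>

text \<open>For p < 1 the space is only quasi-normed, so convexity and duality are not at hand. The
  proof therefore works with p-th powers of norms, written as extended nonnegative integrals
  ("masses"), and needs a metric only to turn compactness into a statement on sequences. The strict
  inequality p < q enters sufficiency through the positive exponent q - p: the point estimate is
  spent on this surplus, and |F|^p is left, whose integral is bounded. In the converse, compactness
  supplies a limit that is not known in advance; norm convergence forces pointwise convergence, and
  this identifies its derivative as 0. Two demands fix N. After the Moebius substitution a factor |1
  + cnj a w|^(N p - 4 - 2 \<alpha>) remains, which is at most a power of 2 if the exponent is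
  nonnegative; and N > (2 + \<alpha>)/p makes the numerator of F_a tend to 0.\<close>

lemma nn_integral_ball_const_le:
  fixes z :: complex
  assumes "0 \<le> r" "ball z r \<subseteq> S" "S \<in> sets lborel" "0 \<le> m"
    and "\<And>w. w \<in> ball z r \<Longrightarrow> m \<le> u w"
  shows "ennreal (pi * r\<^sup>2 * m) \<le> (\<integral>\<^sup>+w\<in>S. ennreal (u w) \<partial>lborel)"
proof -
  have "emeasure lborel (ball z r) = ennreal (pi * r\<^sup>2)"
    using emeasure_ball[of r z] assms(1) by (simp add: unit_ball_vol_2 mult.commute)
  then have "ennreal (pi * r\<^sup>2 * m) = (\<integral>\<^sup>+w. ennreal m * indicator (ball z r) w \<partial>lborel)"
    using assms(1,4) by (subst nn_integral_cmult_indicator) (auto simp: ennreal_mult' mult.commute)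
  also have "\<dots> \<le> (\<integral>\<^sup>+w\<in>S. ennreal (u w) \<partial>lborel)"
    using assms(2,5) by (intro nn_integral_mono) (auto split: split_indicator intro!: ennreal_leI)
  finally show ?thesis .
qed

text \<open>
  Take a maximizer \<open>z\<close> of \<open>(R - |w - a|)\<^sup>2 |F(w)|^p\<close>. There \<open>|F|\<close> is at most \<open>4^(1/p) |F(z)|\<close> on a
  disk of radius comparable to \<open>R - |z - a|\<close>, so by Cauchy's estimate \<open>|F| \<ge> |F(z)| / 2\<close> on a
  comparable disk. This avoids the subharmonicity of \<open>|F|^p\<close> and treats all \<open>p > 0\<close> alike.
\<close>

lemma submean_value_powr:
  fixes p :: real
  assumes "0 < p"
  obtains C where "C > 0"
    "\<And>F a R. 0 < R \<Longrightarrow> F holomorphic_on ball a R \<Longrightarrow> continuous_on (cball a R) F \<Longrightarrow>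
       ennreal (R\<^sup>2 * norm (F a) powr p) \<le>
         ennreal C * (\<integral>\<^sup>+z\<in>ball a R. ennreal (norm (F z) powr p) \<partial>lborel)"
proof
  define K :: real where "K = 4 powr (1 / p)"
  have K1: "K \<ge> 1" using assms by (simp add: K_def ge_one_powr_ge_zero)
  have Kp: "K powr p = 4" using assms by (simp add: K_def powr_powr)
  \<comment> \<open>Calibrated to the last disk, of radius \<open>\<rho> / (4 * K)\<close>, on which
    |F| is at least |F z| / 2: the product with the lower bound there is exactly 4 \<rho>^2 |F z|^p,
    which is \<open>h z\<close>.\<close>
  define C where "C = 64 * K\<^sup>2 * 2 powr p / pi"
  show "C > 0" using K1 by (simp add: C_def)
  fix F :: "complex \<Rightarrow> complex" and a R
  assume R: "0 < R" and hol: "F holomorphic_on ball a R" and cont: "continuous_on (cball a R) F"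
  define h where "h w = (R - dist a w)\<^sup>2 * norm (F w) powr p" for w
  have "continuous_on (cball a R) h"
    unfolding h_def using assms by (intro continuous_intros continuous_on_powr' cont) auto
  then obtain z where z: "z \<in> cball a R" "\<And>w. w \<in> cball a R \<Longrightarrow> h w \<le> h z"
    using continuous_attains_sup[of "cball a R" h] R by auto
  have ha: "R\<^sup>2 * norm (F a) powr p \<le> h z"
    using z(2)[of a] R by (simp add: h_def)
  show "ennreal (R\<^sup>2 * norm (F a) powr p) \<le>
         ennreal C * (\<integral>\<^sup>+z\<in>ball a R. ennreal (norm (F z) powr p) \<partial>lborel)"
  proof (cases "h z = 0")
    case True
    then have "R\<^sup>2 * norm (F a) powr p = 0" using ha
        by (smt (verit) zero_le_mult_iff zero_le_power2 powr_ge_zero)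
    then show ?thesis by auto
  next
    case False
    \<comment> \<open>Half the distance from \<open>z\<close> to the circle: on
      \<open>cball z \<rho>\<close> the factor \<open>R - dist a w\<close> is at least half its
      value at \<open>z\<close>, so maximality of \<open>h z\<close> costs only 2^2 = 4 in
      |F|^p.\<close>
    define \<rho> where "\<rho> = (R - dist a z) / 2"
    have \<rho>: "\<rho> > 0" using z(1) False by (auto simp: \<rho>_def h_def)
    have Fz: "F z \<noteq> 0" using False by (auto simp: h_def)
    have sub: "cball z \<rho> \<subseteq> ball a R"
    proof
      fix w assume "w \<in> cball z \<rho>"
      then have "dist z w \<le> \<rho>" by simp
      moreover have "dist a w \<le> dist a z + dist z w" by (rule dist_triangle)
      ultimately show "w \<in> ball a R" using \<rho> by (auto simp: \<rho>_def field_simps)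
    qed
    have bd: "norm (F w) \<le> K * norm (F z)" if w: "w \<in> cball z \<rho>" for w
    proof -
      have "dist a w \<le> dist a z + dist z w" by (rule dist_triangle)
      then have "\<rho> \<le> R - dist a w" using w by (simp add: \<rho>_def field_simps)
      then have "\<rho>\<^sup>2 * norm (F w) powr p \<le> h w"
        unfolding h_def using \<rho> by (intro mult_right_mono power_mono) auto
      also have "\<dots> \<le> h z" using z(2) sub w by (meson ball_subset_cball subsetD)
      also have "h z = \<rho>\<^sup>2 * (4 * norm (F z) powr p)"
        by (simp add: h_def \<rho>_def power2_eq_square field_simps)
      finally have "norm (F w) powr p \<le> 4 * norm (F z) powr p"
        using \<rho> by simp
      also have "\<dots> = (K * norm (F z)) powr p"
        using K1 by (simp add: powr_mult Kp)
      finally show ?thesis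
        using assms K1 by (meson linorder_not_le norm_ge_zero powr_less_mono2 mult_nonneg_nonneg
            order_trans zero_le_one)
    qed
    have derivb: "norm (deriv F w) \<le> 2 * K * norm (F z) / \<rho>" if w: "w \<in> cball z (\<rho> / 2)" for w
    proof -
      have sub2: "cball w (\<rho> / 2) \<subseteq> cball z \<rho>"
        using w by (subst cball_subset_cball_iff) (auto simp: dist_commute)
      have "norm ((deriv ^^ 1) F w) \<le> fact 1 * (K * norm (F z)) / (\<rho> / 2) ^ 1"
      proof (rule Cauchy_inequality)
        show "F holomorphic_on ball w (\<rho> / 2)"
          using hol sub sub2 ball_subset_cball holomorphic_on_subset by (meson order_trans)
        show "continuous_on (cball w (\<rho> / 2)) F"
          using cont sub sub2 ball_subset_cball continuous_on_subset by (meson order_trans)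
        show "norm (F x) \<le> K * norm (F z)" if "norm (w - x) = \<rho> / 2" for x
          using bd[of x] sub2 that by (auto simp: dist_norm)
      qed (use \<rho> in auto)
      then show ?thesis by (simp add: field_simps)
    qed
    \<comment> \<open>The derivative bound 2 K |F z| / \<rho> times this radius is |F z| /
      2.\<close>
    define \<delta> where "\<delta> = \<rho> / (4 * K)"
    have \<delta>: "\<delta> > 0" "\<delta> \<le> \<rho> / 2" using \<rho> K1 by (auto simp: \<delta>_def field_simps)
    have sub3: "ball z \<delta> \<subseteq> cball z (\<rho> / 2)" "cball z (\<rho> / 2) \<subseteq> ball a R"
      using \<delta> sub \<rho> by auto
    have low: "(norm (F z) / 2) powr p \<le> norm (F w) powr p" if w: "w \<in> ball z \<delta>" for w
    proof -
      have "norm (F w - F z) \<le> (2 * K * norm (F z) / \<rho>) * norm (w - z)"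
      proof (rule field_differentiable_bound)
        show "convex (cball z (\<rho> / 2))" by simp
        show "(F has_field_derivative deriv F x) (at x within cball z (\<rho> / 2))"
          if "x \<in> cball z (\<rho> / 2)" for x
          using hol sub3(2) that
          by (meson holomorphic_derivI open_ball has_field_derivative_at_within subsetD)
      qed (use derivb w sub3 \<rho> in auto)
      also have "\<dots> \<le> (2 * K * norm (F z) / \<rho>) * \<delta>"
        using w \<rho> K1 by (intro mult_left_mono) (auto simp: dist_norm norm_minus_commute)
      also have "\<dots> = norm (F z) / 2" using \<rho> K1 by (simp add: \<delta>_def)
      finally have "norm (F z) / 2 \<le> norm (F w)"
        by (smt (verit) norm_triangle_sub field_sum_of_halves norm_minus_commute)
      then show ?thesis using assms by (intro powr_mono2) auto
    qed
    have "ennreal (pi * \<delta>\<^sup>2 * (norm (F z) / 2) powr p) \<le>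
        (\<integral>\<^sup>+z\<in>ball a R. ennreal (norm (F z) powr p) \<partial>lborel)"
      using \<delta> sub3 low by (intro nn_integral_ball_const_le) auto
    then have "ennreal C * ennreal (pi * \<delta>\<^sup>2 * (norm (F z) / 2) powr p) \<le>
        ennreal C * (\<integral>\<^sup>+z\<in>ball a R. ennreal (norm (F z) powr p) \<partial>lborel)"
      by (rule mult_left_mono) simp
    moreover have "C * (pi * \<delta>\<^sup>2 * (norm (F z) / 2) powr p) = h z"
    proof -
      have "C * (pi * \<delta>\<^sup>2 * (norm (F z) / 2) powr p) = 4 * \<rho>\<^sup>2 * norm (F z) powr p"
        using K1 by (simp add: C_def \<delta>_def powr_divide power2_eq_square field_simps)
      then show ?thesis by (simp add: h_def \<rho>_def power2_eq_square field_simps)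
    qed
    ultimately show ?thesis
      using ha \<open>C > 0\<close> by (simp flip: ennreal_mult') (meson ennreal_leI order_trans)
  qed
qed

text \<open>The p-th power of a weighted Bergman norm for unnormalized area, hence without 1/pi. As
  an \<open>ennreal\<close> it makes sense for every function, and finiteness becomes a conclusion
  instead of a side condition.\<close>

definition bergman_mass :: "real \<Rightarrow> real \<Rightarrow> (complex \<Rightarrow> complex) \<Rightarrow> ennreal" where
  "bergman_mass \<alpha> p F =
     (\<integral>\<^sup>+z\<in>unit_disk. ennreal (norm (F z) powr p * (1 - (norm z)\<^sup>2) powr \<alpha>) \<partial>lborel)"

lemma weight_pos: "norm z < 1 \<Longrightarrow> 0 < 1 - (norm z)\<^sup>2"
  by (simp add: abs_square_less_1)

text \<open>Comparability is assumed in both directions because the sign of the exponent is free: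
  for a >= 0 the bound rests on y <= k x, for a < 0 on x <= k y.\<close>

lemma powr_comparable:
  fixes x y k a :: real
  assumes "0 < y" "1 \<le> k" "y \<le> k * x" "x \<le> k * y"
  shows "y powr a \<le> k powr \<bar>a\<bar> * x powr a"
proof (cases "a \<ge> 0")
  case True
  have "0 < x" using assms by (smt (verit) mult_nonneg_nonpos)
  have "y powr a \<le> (k * x) powr a" using assms True by (intro powr_mono2) auto
  then show ?thesis using True \<open>0 < x\<close> assms by (simp add: powr_mult)
next
  case False
  have "0 < x" using assms by (smt (verit) mult_nonneg_nonpos)
  have "y powr a \<le> (x / k) powr a" using assms False \<open>0 < x\<close>
    by (intro powr_mono2') (auto simp: field_simps)
  also have "\<dots> = k powr \<bar>a\<bar> * x powr a" using False \<open>0 < x\<close> assms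
    by (simp add: powr_divide powr_minus field_simps)
  finally show ?thesis .
qed

text \<open>On this disk 1 - |z| lies between one half and three halves of 1 - |a|, and 1 - t <= 1 -
  t^2 <= 2 (1 - t) on [0, 1) passes this on to the weights.\<close>

lemma weight_comparable:
  fixes a z :: complex
  assumes "norm a < 1" "dist a z < (1 - norm a) / 2"
  shows "norm z < 1" "1 - (norm a)\<^sup>2 \<le> 4 * (1 - (norm z)\<^sup>2)" "1 - (norm z)\<^sup>2 \<le> 4 * (1 - (norm a)\<^sup>2)"
proof -
  have z: "\<bar>norm z - norm a\<bar> < (1 - norm a) / 2"
    using assms(2) norm_triangle_ineq3[of z a] by (simp add: dist_norm norm_minus_commute)
  then show z1: "norm z < 1" by (simp add: abs_if split: if_splits)
  have f: "1 - t\<^sup>2 \<le> 2 * (1 - t)" "1 - t \<le> 1 - t\<^sup>2" if "0 \<le> t" "t < 1" for t :: real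
    using that zero_le_power2[of "1 - t"] by (auto simp: power2_eq_square algebra_simps
        mult_left_le)
  show "1 - (norm a)\<^sup>2 \<le> 4 * (1 - (norm z)\<^sup>2)"
    using f(1)[of "norm a"] f(2)[of "norm z"] z z1 assms(1) by (simp add: abs_if split: if_splits)
  show "1 - (norm z)\<^sup>2 \<le> 4 * (1 - (norm a)\<^sup>2)"
    using f(2)[of "norm a"] f(1)[of "norm z"] z z1 assms(1) by (simp add: abs_if split: if_splits)
qed

text \<open>The sub-mean inequality is applied on a disk of radius R = (1 - |a|)/2, where the weight
  is nearly constant. Its area factor R^2 accounts for the 2 in the exponent \<alpha> + 2, and 1 -
  |a|^2 <= 4 R for the constant 16.\<close>

lemma bergman_point_estimate:
  fixes \<alpha> p :: real
  assumes "0 < p"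
  obtains C where "C > 0"
    "\<And>F a. F holomorphic_on unit_disk \<Longrightarrow> a \<in> unit_disk \<Longrightarrow>
       ennreal (norm (F a) powr p * (1 - (norm a)\<^sup>2) powr (\<alpha> + 2)) \<le> ennreal C * bergman_mass \<alpha> p F"
proof -
  obtain C where C: "C > 0" "\<And>F a R. 0 < R \<Longrightarrow> F holomorphic_on ball a R \<Longrightarrow>
      continuous_on (cball a R) F \<Longrightarrow>
       ennreal (R\<^sup>2 * norm (F a) powr p) \<le>
         ennreal C * (\<integral>\<^sup>+z\<in>ball a R. ennreal (norm (F z) powr p) \<partial>lborel)"
    using submean_value_powr[OF assms] by blast
  show ?thesis
  proof (rule that)
    show "16 * C * 4 powr \<bar>\<alpha>\<bar> > 0" using C(1) by simp
    fix F a assume F: "F holomorphic_on unit_disk" and a: "a \<in> unit_disk"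
    define R where "R = (1 - norm a) / 2"
    define d where "d = 1 - (norm a)\<^sup>2"
    have a1: "norm a < 1" using a by simp
    have R: "R > 0" using a1 by (simp add: R_def)
    have d: "d > 0" using a1 weight_pos by (simp add: d_def)
    have dR: "d \<le> 4 * R"
      using zero_le_power2[of "1 - norm a"] by (simp add: d_def R_def power2_eq_square
          algebra_simps)
    have cb: "cball a R \<subseteq> unit_disk"
    proof
      fix z assume "z \<in> cball a R"
      then have "norm (z - a) \<le> R" by (simp add: dist_norm norm_minus_commute)
      then show "z \<in> unit_disk" using norm_triangle_sub[of z a] a1 by (simp add: R_def field_simps)
    qed
    then have b: "ball a R \<subseteq> unit_disk" by (meson ball_subset_cball order_trans)
    have meas: "F \<in> borel_measurable (restrict_space borel unit_disk)"
      using F holomorphic_on_imp_continuous_on borel_measurable_continuous_on_restrict by blast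
    have ind: "(\<lambda>z. ennreal (norm (F z) powr p) * indicator (ball a R) z) \<in> borel_measurable lborel"
    proof -
      have "(\<lambda>z. ennreal (norm (F z) powr p)) \<in> borel_measurable (restrict_space borel (ball a R))"
        using measurable_restrict_mono[OF meas b] by measurable
      then show ?thesis
        by (subst (asm) borel_measurable_restrict_space_iff_ennreal) auto
    qed
    have "norm (F a) powr p * d powr (\<alpha> + 2) = norm (F a) powr p * d\<^sup>2 * d powr \<alpha>"
      using d by (simp add: powr_add powr_realpow flip: powr_numeral)
    also have "\<dots> \<le> norm (F a) powr p * (4 * R)\<^sup>2 * d powr \<alpha>"
      using d dR by (intro mult_right_mono mult_left_mono power_mono) auto
    finally have 1: "norm (F a) powr p * d powr (\<alpha> + 2) \<le> 16 * d powr \<alpha> * (R\<^sup>2 * norm (F a) powr p)"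
      by (simp add: power2_eq_square mult_ac)
    then have "ennreal (norm (F a) powr p * d powr (\<alpha> + 2)) \<le>
        ennreal (16 * d powr \<alpha>) * ennreal (R\<^sup>2 * norm (F a) powr p)"
      by (simp add: ennreal_leI flip: ennreal_mult')
    also have "\<dots> \<le> ennreal (16 * d powr \<alpha>) * (ennreal C * (\<integral>\<^sup>+z\<in>ball a R. ennreal (norm (F z) powr
        p) \<partial>lborel))"
      using F cb b R holomorphic_on_imp_continuous_on[OF holomorphic_on_subset[OF F cb]]
      by (intro mult_left_mono C(2)) (auto intro: holomorphic_on_subset)
    also have "\<dots> = ennreal (16 * C) * (\<integral>\<^sup>+z. ennreal (d powr \<alpha>) * (ennreal (norm (F z) powr p) *
        indicator (ball a R) z) \<partial>lborel)"
      using C(1) unfolding nn_integral_cmult[OF ind] by (simp add: ennreal_mult' mult_ac)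
    also have "\<dots> \<le> ennreal (16 * C) * (\<integral>\<^sup>+z. ennreal (4 powr \<bar>\<alpha>\<bar>) *
        (ennreal (norm (F z) powr p * (1 - (norm z)\<^sup>2) powr \<alpha>) * indicator (ball a R) z) \<partial>lborel)"
    proof (intro mult_left_mono nn_integral_mono)
      fix z
      show "ennreal (d powr \<alpha>) * (ennreal (norm (F z) powr p) * indicator (ball a R) z) \<le>
          ennreal (4 powr \<bar>\<alpha>\<bar>) * (ennreal (norm (F z) powr p * (1 - (norm z)\<^sup>2) powr \<alpha>) * indicator
              (ball a R) z)"
      proof (cases "z \<in> ball a R")
        case True
        then have "d powr \<alpha> \<le> 4 powr \<bar>\<alpha>\<bar> * (1 - (norm z)\<^sup>2) powr \<alpha>"
          using weight_comparable[of a z] a1 d unfolding d_def R_def by (intro powr_comparable) auto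
        then have "d powr \<alpha> * norm (F z) powr p \<le>
            4 powr \<bar>\<alpha>\<bar> * (1 - (norm z)\<^sup>2) powr \<alpha> * norm (F z) powr p"
          by (rule mult_right_mono) simp
        then show ?thesis using True by (simp add: ennreal_leI mult_ac flip: ennreal_mult')
      qed simp
    qed simp
    also have "\<dots> = ennreal (16 * C * 4 powr \<bar>\<alpha>\<bar>) * (\<integral>\<^sup>+z.
        (ennreal (norm (F z) powr p * (1 - (norm z)\<^sup>2) powr \<alpha>) * indicator (ball a R) z) \<partial>lborel)"
    proof (subst nn_integral_cmult)
      have "(\<lambda>z. ennreal (norm (F z) powr p) * indicator (ball a R) z * ennreal ((1 - (norm z)\<^sup>2)
          powr \<alpha>)) \<in> borel_measurable lborel"
        using ind by measurable
      then show "(\<lambda>z. ennreal (norm (F z) powr p * (1 - (norm z)\<^sup>2) powr \<alpha>) * indicator (ball a R)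
          z) \<in> borel_measurable lborel"
        by (simp add: ennreal_mult' mult_ac)
    qed (use C(1) in \<open>simp add: ennreal_mult' mult_ac\<close>)
    also have "\<dots> \<le> ennreal (16 * C * 4 powr \<bar>\<alpha>\<bar>) * bergman_mass \<alpha> p F"
      unfolding bergman_mass_def using b
      by (intro mult_left_mono nn_integral_mono) (auto split: split_indicator)
    finally show "ennreal (norm (F a) powr p * (1 - (norm a)\<^sup>2) powr (\<alpha> + 2)) \<le>
        ennreal (16 * C * 4 powr \<bar>\<alpha>\<bar>) * bergman_mass \<alpha> p F"
      by (simp add: d_def)
  qed
qed

section \<open>Integrals over the disk\<close>

lemma bergman_mass_one_finite:
  fixes \<alpha> p :: real
  assumes "\<alpha> > -1"
  shows "bergman_mass \<alpha> p (\<lambda>_. 1) < \<infinity>"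
proof -
  \<comment> \<open>dyadic annuli; \<open>|z|\<^sup>2\<close> is uniformly distributed, so \<open>E k\<close> has area \<open>pi 2^-(k+1)\<close>\<close>
  define E where "E k = {z::complex. 1 - (1/2) ^ k \<le> (norm z)\<^sup>2 \<and> (norm z)\<^sup>2 <
      1 - (1/2) ^ Suc k}" for k :: nat
  \<comment> \<open>One constant for both signs of \<alpha>: on \<open>E k\<close> the weight lies
    between 2^-(k+1) and 2^-k. The upper end serves \<alpha> >= 0; the lower end serves \<alpha> < 0
    and costs 2^(-\<alpha>).\<close>
  define c :: real where "c = 1 + 2 powr (- \<alpha>)"
  have E_eq: "E k = ball 0 (sqrt (1 - (1/2) ^ Suc k)) - ball 0 (sqrt (1 - (1/2) ^ k))" for k
    by (auto simp: E_def real_less_rsqrt real_le_rsqrt not_less real_sqrt_le_iff real_less_lsqrt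
        real_le_lsqrt sqrt_le_D)
      (smt (verit) real_sqrt_le_iff real_sqrt_less_iff real_sqrt_abs abs_norm_cancel)+
  have meas: "E k \<in> sets lborel" for k unfolding E_eq by auto
  have em: "emeasure lborel (E k) = ennreal (pi * (1/2) ^ Suc k)" for k
  proof -
    have le: "(1/2::real) ^ Suc k \<le> (1/2) ^ k" "(1/2::real) ^ k \<le> 1" by (auto simp: power_le_one)
    have "emeasure lborel (E k) = emeasure lborel (ball (0::complex) (sqrt (1 - (1/2) ^ Suc k)))
        - emeasure lborel (ball (0::complex) (sqrt (1 - (1/2) ^ k)))"
      unfolding E_eq using le
      by (intro emeasure_Diff) (auto simp: emeasure_lborel_ball_finite less_top[symmetric]
          emeasure_ball intro!: subset_ball)
    also have "\<dots> = ennreal (pi * (1 - (1/2) ^ Suc k)) - ennreal (pi * (1 - (1/2) ^ k))"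
      using le by (simp add: emeasure_ball unit_ball_vol_2 mult.commute)
    also have "\<dots> = ennreal (pi * (1/2) ^ Suc k)"
      using le by (subst ennreal_minus) (auto simp: algebra_simps)
    finally show ?thesis .
  qed
  have pt: "\<exists>k. z \<in> E k" if "norm z < 1" for z
  proof -
    have "\<exists>n. (1/2) ^ n < 1 - (norm z)\<^sup>2"
      using weight_pos[OF that] by (intro real_arch_pow_inv) auto
    then obtain n where n: "(1/2) ^ n < 1 - (norm z)\<^sup>2" "\<And>m. m < n \<Longrightarrow> \<not> (1/2) ^ m < 1 - (norm z)\<^sup>2"
      by (subst (asm) exists_least_iff) blast
    \<comment> \<open>\<open>n\<close> is the least index with 2^-n below 1 - |z|^2. That number is
      at most 1, so \<open>n\<close> is positive, and its predecessor is the index of the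
      annulus.\<close>
    have "n \<noteq> 0" using n(1) by (auto intro!: Nat.gr0I)
    then obtain k where k: "n = Suc k" using not0_implies_Suc by auto
    show ?thesis using n(1) n(2)[of k] k by (intro exI[of _ k]) (auto simp: E_def)
  qed
  have bd: "(1 - (norm z)\<^sup>2) powr \<alpha> \<le> c * 2 powr (- \<alpha> * real k)" if "z \<in> E k" for z k
  proof -
    have 1: "(1/2) ^ Suc k \<le> 1 - (norm z)\<^sup>2" "1 - (norm z)\<^sup>2 \<le> (1/2) ^ k"
      using that by (auto simp: E_def)
    have h: "((1/2::real) ^ j) powr \<alpha> = 2 powr (- \<alpha> * real j)" for j
      by (simp add: powr_powr mult.commute powr_minus_divide flip: powr_realpow powr_divide)
        (simp add: powr_divide powr_minus_divide powr_powr mult.commute)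
    show ?thesis
    proof (cases "\<alpha> \<ge> 0")
      case True
      have "(1 - (norm z)\<^sup>2) powr \<alpha> \<le> ((1/2) ^ k) powr \<alpha>"
        using 1 True by (intro powr_mono2) (auto intro: order_trans[rotated])
      also have "\<dots> \<le> c * 2 powr (- \<alpha> * real k)"
        unfolding h by (simp add: c_def)
      finally show ?thesis .
    next
      case False
      have "(1 - (norm z)\<^sup>2) powr \<alpha> \<le> ((1/2) ^ Suc k) powr \<alpha>"
        using 1 False by (intro powr_mono2') auto
      also have "\<dots> = 2 powr (- \<alpha>) * 2 powr (- \<alpha> * real k)"
        unfolding h by (simp add: powr_add[symmetric] algebra_simps)
      also have "\<dots> \<le> c * 2 powr (- \<alpha> * real k)"
        by (simp add: c_def)
      finally show ?thesis .
    qed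
  qed
  have suminf_ge: "f k \<le> suminf f" for f :: "nat \<Rightarrow> ennreal" and k
    using sum_le_suminf[of f "{k}"] by simp
  \<comment> \<open>The weight contributes 2^(-\<alpha> k) and the area 2^-(k+1), so the series is
    geometric with this ratio; it is below 1 exactly when \<alpha> > -1.\<close>
  define r :: real where "r = 2 powr (- 1 - \<alpha>)"
  have r: "0 < r" "r < 1" using assms by (auto simp: r_def powr_less_one)
  have "bergman_mass \<alpha> p (\<lambda>_. 1) \<le> (\<integral>\<^sup>+z. (\<Sum>k. ennreal (c * 2 powr (- \<alpha> * real k)) * indicator (E k)
      z) \<partial>lborel)"
    unfolding bergman_mass_def
  proof (rule nn_integral_mono)
    fix z :: complex
    show "ennreal (norm (1::complex) powr p * (1 - (norm z)\<^sup>2) powr \<alpha>) * indicator unit_disk z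
        \<le> (\<Sum>k. ennreal (c * 2 powr (- \<alpha> * real k)) * indicator (E k) z)"
    proof (cases "norm z < 1")
      case True
      then obtain k where k: "z \<in> E k" using pt by auto
      have "ennreal (norm (1::complex) powr p * (1 - (norm z)\<^sup>2) powr \<alpha>) * indicator unit_disk z
          \<le> ennreal (c * 2 powr (- \<alpha> * real k)) * indicator (E k) z"
        using True k bd[OF k] by (auto intro!: ennreal_leI)
      also have "\<dots> \<le> (\<Sum>k. ennreal (c * 2 powr (- \<alpha> * real k)) * indicator (E k) z)"
        by (rule suminf_ge)
      finally show ?thesis .
    qed simp
  qed
  also have "\<dots> = (\<Sum>k. \<integral>\<^sup>+z. ennreal (c * 2 powr (- \<alpha> * real k)) * indicator (E k) z \<partial>lborel)"
    using meas by (intro nn_integral_suminf) auto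
  also have "\<dots> = (\<Sum>k. ennreal (c * pi / 2 * r ^ k))"
  proof (rule suminf_cong)
    fix k
    have "r ^ k = 2 powr (- \<alpha> * real k) * (1/2) ^ k"
      unfolding r_def
      by (simp add: powr_power powr_powr powr_diff powr_add powr_minus field_simps flip:
          powr_realpow)
    then have eq: "c * 2 powr (- \<alpha> * real k) * (pi * (1/2) ^ Suc k) = c * pi / 2 * r ^ k"
      by simp
    have "c \<ge> 0" by (simp add: c_def)
    have "(\<integral>\<^sup>+z. ennreal (c * 2 powr (- \<alpha> * real k)) * indicator (E k) z \<partial>lborel)
        = ennreal (c * 2 powr (- \<alpha> * real k)) * ennreal (pi * (1/2) ^ Suc k)"
      using meas unfolding em[symmetric] by (intro nn_integral_cmult_indicator)
    also have "\<dots> = ennreal (c * 2 powr (- \<alpha> * real k) * (pi * (1/2) ^ Suc k))"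
      using \<open>c \<ge> 0\<close> by (intro ennreal_mult'[symmetric]) auto
    finally show "(\<integral>\<^sup>+z. ennreal (c * 2 powr (- \<alpha> * real k)) * indicator (E k) z \<partial>lborel) =
        ennreal (c * pi / 2 * r ^ k)"
      unfolding eq .
  qed
  also have "\<dots> = ennreal (\<Sum>k. c * pi / 2 * r ^ k)"
    using r by (intro suminf_ennreal2 summable_mult summable_geometric) (auto simp: c_def)
  also have "\<dots> < \<infinity>" by simp
  finally show ?thesis .
qed

text \<open>The library states change of variables only for \<open>real ^ 'n\<close>.\<close>

definition complex_of_vec :: "real ^ 2 \<Rightarrow> complex" where
  "complex_of_vec v = Complex (v $ 1) (v $ 2)"

definition vec_of_complex :: "complex \<Rightarrow> real ^ 2" where
  "vec_of_complex z = vector [Re z, Im z]"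

lemma complex_of_vec_of_complex [simp]: "complex_of_vec (vec_of_complex z) = z"
  and vec_of_complex_of_vec [simp]: "vec_of_complex (complex_of_vec v) = v"
  by (simp_all add: complex_of_vec_def vec_of_complex_def vec_eq_iff forall_2)

lemma linear_complex_of_vec: "linear complex_of_vec"
  and linear_vec_of_complex: "linear vec_of_complex"
  by (auto intro!: linearI simp: complex_of_vec_def vec_of_complex_def complex_eq_iff vec_eq_iff
      forall_2)

lemma bounded_linear_complex_of_vec: "bounded_linear complex_of_vec"
  and bounded_linear_vec_of_complex: "bounded_linear vec_of_complex"
  by (simp_all add: linear_complex_of_vec linear_vec_of_complex linear_linear)

lemma complex_of_vec_measurable [measurable]: "complex_of_vec \<in> borel_measurable borel"
  by (intro borel_measurable_continuous_onI linear_continuous_on bounded_linear_complex_of_vec)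

text \<open>Lebesgue measure is determined by its values on boxes, and the coordinate map matches
  boxes of equal side lengths.\<close>

lemma lborel_complex_eq_distr: "(lborel :: complex measure) = distr lborel borel complex_of_vec"
proof (rule lborel_eqI)
  fix l u :: complex
  assume le: "\<And>b. b \<in> Basis \<Longrightarrow> l \<bullet> b \<le> u \<bullet> b"
  have le': "Re l \<le> Re u" "Im l \<le> Im u"
    using le[of 1] le[of \<i>] by (auto simp: Basis_complex_def)
  have inj: "inj (\<lambda>i::2. axis i (1::real))" by (auto simp: inj_def axis_eq_axis)
  have B: "(Basis :: (real ^ 2) set) = range (\<lambda>i. axis i 1)"
    by (auto simp: Basis_vec_def)
  have "complex_of_vec -` box l u = box (vec_of_complex l) (vec_of_complex u)"
    by (auto simp: complex_of_vec_def vec_of_complex_def mem_box_cart forall_2 in_box_complex_iff)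
  then have "emeasure (distr lborel borel complex_of_vec) (box l u)
      = emeasure lborel (box (vec_of_complex l) (vec_of_complex u))"
    by (simp add: emeasure_distr)
  also have "\<dots> = (\<Prod>b\<in>Basis. (vec_of_complex u - vec_of_complex l) \<bullet> b)"
    using le' by (intro emeasure_lborel_box) (auto simp: B inner_axis vec_of_complex_def UNIV_2)
  also have "(\<Prod>b\<in>Basis. (vec_of_complex u - vec_of_complex l) \<bullet> b) = (\<Prod>b\<in>Basis. (u - l) \<bullet> b)"
    unfolding B by (subst prod.reindex[OF inj]) (simp add: UNIV_2 inner_axis vec_of_complex_def
        Basis_complex_def)
  finally show "emeasure (distr lborel borel complex_of_vec) (box l u) = (\<Prod>b\<in>Basis. (u - l) \<bullet> b)" .
qed simp

lemma nn_integral_complex_eq_vec: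
  assumes "f \<in> borel_measurable borel"
  shows "(\<integral>\<^sup>+z. f z \<partial>(lborel :: complex measure)) = (\<integral>\<^sup>+v. f (complex_of_vec v) \<partial>lborel)"
  using assms by (subst lborel_complex_eq_distr) (simp add: nn_integral_distr)

text \<open>By the Cauchy-Riemann equations the real derivative of a holomorphic map is
  multiplication by its complex derivative, so this determinant is the Jacobian |\<phi>'|^2.\<close>

lemma det_matrix_complex_mult:
  "det (matrix (\<lambda>v. vec_of_complex (a * complex_of_vec v))) = (norm a)\<^sup>2"
  unfolding cmod_power2
  by (simp add: det_2 matrix_def complex_of_vec_def vec_of_complex_def axis_def power2_eq_square)

text \<open>Stated as an inequality, so that no injectivity of \<open>\<phi>\<close> has to be
  shown: points covered several times only enlarge the right side.\<close>

lemma nn_integral_holomorphic_image_le: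
  fixes u :: "complex \<Rightarrow> real"
  assumes S: "open S" and hol: "\<phi> holomorphic_on S" and im: "open (\<phi> ` S)"
    and u: "continuous_on (\<phi> ` S) u" "\<And>z. z \<in> \<phi> ` S \<Longrightarrow> 0 \<le> u z"
  shows "(\<integral>\<^sup>+z\<in>\<phi> ` S. ennreal (u z) \<partial>lborel) \<le>
    (\<integral>\<^sup>+z\<in>S. ennreal ((norm (deriv \<phi> z))\<^sup>2 * u (\<phi> z)) \<partial>lborel)"
proof (cases "(\<integral>\<^sup>+z\<in>S. ennreal ((norm (deriv \<phi> z))\<^sup>2 * u (\<phi> z)) \<partial>lborel)")
  \<comment> \<open>Only a finite right side requires an argument; its value \<open>r\<close>
    supplies the integrability that the change of variables asks for.\<close>
  case (real r)
  define w where "w z = (norm (deriv \<phi> z))\<^sup>2 * u (\<phi> z)" for z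
  have cw: "continuous_on S w"
    unfolding w_def using hol S
    by (intro continuous_intros continuous_on_compose2[OF u(1)] holomorphic_on_imp_continuous_on
        holomorphic_deriv) auto
  have mw: "(\<lambda>z. indicator S z *\<^sub>R w z) \<in> borel_measurable borel"
    using S cw by (intro borel_measurable_continuous_on_indicator) auto
  have mu: "(\<lambda>z. indicator (\<phi> ` S) z *\<^sub>R u z) \<in> borel_measurable borel"
    using im u by (intro borel_measurable_continuous_on_indicator) auto
  define S' where "S' = complex_of_vec -` S"
  have w0: "0 \<le> indicator S z *\<^sub>R w z" for z
    using u(2) by (auto simp: w_def indicator_def)
  have "(\<integral>\<^sup>+z. ennreal (indicator S z *\<^sub>R w z) \<partial>lborel) = ennreal r"
    using real unfolding w_def[symmetric] by (simp add: ennreal_mult'' ennreal_indicator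
        mult.commute)
  then have "(\<integral>\<^sup>+v. ennreal (indicator S (complex_of_vec v) *\<^sub>R w (complex_of_vec v)) \<partial>lborel) =
      ennreal r"
    using mw by (subst (asm) nn_integral_complex_eq_vec) auto
  then have "((\<lambda>v. indicator S (complex_of_vec v) *\<^sub>R w (complex_of_vec v)) has_integral r) UNIV"
    using mw w0 real(1) by (intro nn_integral_has_integral) auto
  then have "((\<lambda>v. if v \<in> S' then w (complex_of_vec v) else 0) has_integral r) UNIV"
    by (rule has_integral_eq[rotated]) (simp add: S'_def indicator_def)
  then have I: "((\<lambda>v. w (complex_of_vec v)) has_integral r) S'"
    by (simp add: has_integral_restrict_UNIV)
  define \<gamma> where "\<gamma> v = vec_of_complex (\<phi> (complex_of_vec v))" for v
  define \<gamma>' where "\<gamma>' v h = vec_of_complex (deriv \<phi> (complex_of_vec v) * complex_of_vec h)" for v h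
  have det: "\<bar>det (matrix (\<gamma>' v))\<bar> * u (complex_of_vec (\<gamma> v)) = w (complex_of_vec v)" for v
    by (simp add: \<gamma>'_def[abs_def] det_matrix_complex_mult \<gamma>_def w_def)
  have "(\<lambda>v. u (complex_of_vec v)) integrable_on (\<gamma> ` S') \<and>
      integral (\<gamma> ` S') (\<lambda>v. u (complex_of_vec v)) \<le>
          integral S' (\<lambda>v. \<bar>det (matrix (\<gamma>' v))\<bar> * u (complex_of_vec (\<gamma> v)))"
  proof (rule integral_on_image_ubound_nonneg)
    fix v assume v: "v \<in> S'"
    then show "0 \<le> u (complex_of_vec (\<gamma> v))" using u(2) by (simp add: \<gamma>_def S'_def)
    have "(\<phi> has_derivative (*) (deriv \<phi> (complex_of_vec v))) (at (complex_of_vec v))"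
      using hol S v holomorphic_derivI[of \<phi> S "complex_of_vec v"]
      by (simp add: S'_def has_field_derivative_def)
    then have "(\<gamma> has_derivative \<gamma>' v) (at v)"
      unfolding \<gamma>_def[abs_def] \<gamma>'_def[abs_def]
      by (intro bounded_linear.has_derivative[OF bounded_linear_vec_of_complex]
          has_derivative_compose[OF bounded_linear.has_derivative[OF bounded_linear_complex_of_vec]]
              has_derivative_ident)
    then show "(\<gamma> has_derivative \<gamma>' v) (at v within S')"
      by (rule has_derivative_at_withinI)
  qed (use I in \<open>auto simp: det integrable_on_def\<close>)
  then have le: "(\<lambda>v. u (complex_of_vec v)) integrable_on (\<gamma> ` S')"
      "integral (\<gamma> ` S') (\<lambda>v. u (complex_of_vec v)) \<le> r"
    using I by (auto simp: det integral_unique)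
  have img: "v \<in> \<gamma> ` S' \<longleftrightarrow> complex_of_vec v \<in> \<phi> ` S" for v
  proof
    assume "complex_of_vec v \<in> \<phi> ` S"
    then obtain z where "z \<in> S" "complex_of_vec v = \<phi> z" by blast
    then have "v = \<gamma> (vec_of_complex z)" "vec_of_complex z \<in> S'"
      by (auto simp: \<gamma>_def S'_def) (metis vec_of_complex_of_vec)
    then show "v \<in> \<gamma> ` S'" by blast
  qed (auto simp: \<gamma>_def S'_def)
  have "(\<integral>\<^sup>+z\<in>\<phi> ` S. ennreal (u z) \<partial>lborel) = (\<integral>\<^sup>+z. ennreal (indicator (\<phi> ` S) z *\<^sub>R u z) \<partial>lborel)"
    by (intro nn_integral_cong) (auto split: split_indicator)
  also have "\<dots> = (\<integral>\<^sup>+v. ennreal (indicator (\<phi> ` S) (complex_of_vec v) *\<^sub>R u (complex_of_vec v))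
      \<partial>lborel)"
    using mu by (subst nn_integral_complex_eq_vec) auto
  also have "\<dots> = (\<integral>\<^sup>+v. ennreal (indicator (\<gamma> ` S') v * u (complex_of_vec v)) \<partial>lborel)"
    using img by (intro nn_integral_cong) (auto simp: indicator_def)
  also have "\<dots> = ennreal (integral (\<gamma> ` S') (\<lambda>v. u (complex_of_vec v)))"
    using le(1) u(2) img by (intro nn_integral_has_integral_lebesgue) auto
  also have "\<dots> \<le> ennreal r"
    using le(2) by (rule ennreal_leI)
  finally show ?thesis using real by simp
qed simp

section \<open>Test functions\<close>

text \<open>At z = a the modulus is (1 - |a|^2)^(-(2 + \<alpha>)/p), up to a constant the largest
  growth that the point estimate allows for bounded mass. A natural \<open>N\<close> keeps the
  function free of branches.\<close>

definition test_function :: "real \<Rightarrow> real \<Rightarrow> nat \<Rightarrow> complex \<Rightarrow> complex \<Rightarrow> complex" where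
  "test_function \<alpha> p N a z =
     of_real ((1 - (norm a)\<^sup>2) powr (real N - (2 + \<alpha>) / p)) / (1 - cnj a * z) ^ N"

lemma one_minus_cnj_mult_nz:
  assumes "norm a < 1" "norm z < 1"
  shows "1 - cnj a * z \<noteq> 0"
proof -
  have "norm (cnj a * z) < 1 * 1"
    using assms unfolding norm_mult by (intro mult_strict_mono') auto
  then show ?thesis by auto
qed

lemma holomorphic_test_function:
  "norm a < 1 \<Longrightarrow> test_function \<alpha> p N a holomorphic_on unit_disk"
  unfolding test_function_def using one_minus_cnj_mult_nz by (intro holomorphic_intros) auto

text \<open>Under z = \<phi>(w) all powers of 1 - |a|^2 cancel, and |1 + cnj a w|^(N p - 4 - 2
  \<alpha>) (1 - |w|^2)^\<alpha> is left. The condition on \<open>N\<close> makes the exponent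
  nonnegative, so the modulus may be replaced by its bound 2.\<close>

lemma bergman_mass_test_function:
  fixes \<alpha> p :: real
  assumes p: "0 < p" and N: "4 + 2 * \<alpha> \<le> real N * p" and a: "norm a < 1"
  shows "bergman_mass \<alpha> p (test_function \<alpha> p N a) \<le>
     ennreal (2 powr (real N * p - 4 - 2 * \<alpha>)) * bergman_mass \<alpha> p (\<lambda>_. 1)"
proof -
  \<comment> \<open>The sign is chosen so that \<open>\<phi>\<close> sends 0 to \<open>a\<close>,
    where the test function is concentrated.\<close>
  define \<phi> where "\<phi> = Moebius_function 0 (- a)"
  define d where "d = 1 - (norm a)\<^sup>2"
  have d: "d > 0" using a weight_pos by (simp add: d_def)
  have dc: "complex_of_real d = 1 - cnj a * a"
    unfolding d_def of_real_diff complex_norm_square by (simp add: mult.commute)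
  have \<phi>: "\<phi> w = (w + a) / (1 + cnj a * w)" for w by (simp add: \<phi>_def Moebius_function_simple)
  have nz: "1 + cnj a * w \<noteq> 0" if "norm w < 1" for w
    using one_minus_cnj_mult_nz[of "- a" w] a that by simp
  have hol: "\<phi> holomorphic_on unit_disk"
    using a unfolding \<phi>_def by (intro Moebius_function_holomorphic) simp
  have im: "\<phi> ` unit_disk = unit_disk"
  proof
    show "\<phi> ` unit_disk \<subseteq> unit_disk"
      using Moebius_function_norm_lt_1 a by (auto simp: \<phi>_def)
    show "unit_disk \<subseteq> \<phi> ` unit_disk"
    proof
      fix z assume z: "z \<in> unit_disk"
      then have "\<phi> (Moebius_function 0 a z) = z"
        using a unfolding \<phi>_def by (intro Moebius_function_compose) auto
      moreover have "Moebius_function 0 a z \<in> unit_disk"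
        using Moebius_function_norm_lt_1 a z by simp
      ultimately show "z \<in> \<phi> ` unit_disk" by (metis imageI)
    qed
  qed
  have deriv: "deriv \<phi> w = of_real d / (1 + cnj a * w)\<^sup>2" if "norm w < 1" for w
    unfolding \<phi>[abs_def] dc using nz[OF that]
    by (intro DERIV_imp_deriv) (auto intro!: derivative_eq_intros simp: power2_eq_square
        algebra_simps)
  have den: "1 - cnj a * \<phi> w = of_real d / (1 + cnj a * w)" if "norm w < 1" for w
    unfolding \<phi> dc using nz[OF that] by (simp add: field_simps)
  have wt: "1 - (norm (\<phi> w))\<^sup>2 = d * (1 - (norm w)\<^sup>2) / (norm (1 + cnj a * w))\<^sup>2" if "norm w <
      1" for w
  proof -
    have nz2: "1 + a * cnj w \<noteq> 0"
      using nz[OF that] by (metis complex_cnj_add complex_cnj_cnj complex_cnj_mult complex_cnj_one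
          complex_cnj_zero)
    have "complex_of_real (1 - (norm (\<phi> w))\<^sup>2) = 1 - \<phi> w * cnj (\<phi> w)"
      unfolding of_real_diff complex_norm_square by simp
    also have "\<dots> = (1 - cnj a * a) * (1 - w * cnj w) / ((1 + cnj a * w) * cnj (1 + cnj a * w))"
      unfolding \<phi> using nz[OF that] nz2 by (simp add: divide_simps) (simp add: algebra_simps)
    also have "\<dots> = complex_of_real (d * (1 - (norm w)\<^sup>2) / (norm (1 + cnj a * w))\<^sup>2)"
      unfolding of_real_divide of_real_mult of_real_diff complex_norm_square dc by simp
    finally show ?thesis using of_real_eq_iff by blast
  qed
  define u where "u z = norm (test_function \<alpha> p N a z) powr p * (1 - (norm z)\<^sup>2) powr \<alpha>" for z
  have cu: "continuous_on unit_disk u"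
  proof -
    have "continuous_on unit_disk (\<lambda>z. norm (test_function \<alpha> p N a z) powr p)"
      using p a by (intro continuous_on_powr' continuous_intros holomorphic_on_imp_continuous_on
          holomorphic_test_function) auto
    moreover have "continuous_on unit_disk (\<lambda>z::complex. (1 - (norm z)\<^sup>2) powr \<alpha>)"
      by (intro continuous_on_powr continuous_intros) (force dest: weight_pos)
    ultimately show ?thesis unfolding u_def by (rule continuous_on_mult)
  qed
  have pt: "(norm (deriv \<phi> w))\<^sup>2 * u (\<phi> w) \<le> 2 powr (real N * p - 4 - 2 * \<alpha>) * (1 - (norm w)\<^sup>2) powr
      \<alpha>"
    if w: "norm w < 1" for w
  proof -
    define s where "s = norm (1 + cnj a * w)"
    have s: "s > 0" using nz[OF w] by (simp add: s_def)
    have "s \<le> 1 + norm a * norm w" unfolding s_def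
        by (metis complex_mod_cnj norm_mult norm_one norm_triangle_ineq)
    also have "\<dots> \<le> 1 + 1 * 1" using a w by (intro add_left_mono mult_mono) auto
    finally have s2: "s \<le> 2" by simp
    have w0: "1 - (norm w)\<^sup>2 > 0" using w weight_pos by simp
    have "norm (test_function \<alpha> p N a (\<phi> w)) = d powr (real N - (2 + \<alpha>) / p) / (d / s) ^ N"
      using d by (simp add: test_function_def den[OF w] norm_divide norm_power s_def flip: d_def)
    also have "real N - (2 + \<alpha>) / p = - (2 + \<alpha>) / p + real N"
      by (simp add: minus_divide_left)
    also have "d powr (- (2 + \<alpha>) / p + real N) / (d / s) ^ N =
        d powr (- (2 + \<alpha>) / p) * s powr real N"
      using d s unfolding powr_add by (simp add: powr_realpow power_divide)
    finally have 1: "norm (test_function \<alpha> p N a (\<phi> w)) powr p =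
        d powr (- (2 + \<alpha>)) * s powr (real N * p)"
      using d s p by (simp add: powr_mult powr_powr)
    have 2: "(1 - (norm (\<phi> w))\<^sup>2) powr \<alpha> = d powr \<alpha> * (1 - (norm w)\<^sup>2) powr \<alpha> * s powr (- 2 * \<alpha>)"
    proof -
      have "(1 - (norm (\<phi> w))\<^sup>2) powr \<alpha> = (d * (1 - (norm w)\<^sup>2) / s powr 2) powr \<alpha>"
        using s unfolding wt[OF w] by (simp flip: s_def)
      also have "\<dots> = d powr \<alpha> * (1 - (norm w)\<^sup>2) powr \<alpha> / s powr (2 * \<alpha>)"
        using d s w0 by (simp only: powr_divide powr_mult powr_powr)
      finally show ?thesis by (simp add: powr_minus divide_inverse)
    qed
    have 3: "(norm (deriv \<phi> w))\<^sup>2 = d powr 2 * s powr (- 4)"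
      using d s unfolding deriv[OF w] norm_divide norm_power s_def[symmetric]
      by (simp add: power_divide powr_minus divide_inverse power_mult_distrib power_inverse flip:
          power_mult)
    have "(norm (deriv \<phi> w))\<^sup>2 * u (\<phi> w) =
        (d powr 2 * d powr (- (2 + \<alpha>)) * d powr \<alpha>) * (s powr (- 4) * s powr (real N * p) * s powr (-
            2 * \<alpha>)) * (1 - (norm w)\<^sup>2) powr \<alpha>"
      unfolding u_def 1 2 3 by (simp add: mult_ac)
    \<comment> \<open>The three exponents come from the Jacobian, the test function and the weight,
      and add up to 0.\<close>
    also have "d powr 2 * d powr (- (2 + \<alpha>)) * d powr \<alpha> = 1"
      using d unfolding powr_add[symmetric] by simp
    also have "s powr (- 4) * s powr (real N * p) * s powr (- 2 * \<alpha>) =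
        s powr (real N * p - 4 - 2 * \<alpha>)"
      unfolding powr_add[symmetric] by (simp add: algebra_simps)
    also have "1 * s powr (real N * p - 4 - 2 * \<alpha>) * (1 - (norm w)\<^sup>2) powr \<alpha> \<le>
        2 powr (real N * p - 4 - 2 * \<alpha>) * (1 - (norm w)\<^sup>2) powr \<alpha>"
      using s s2 N unfolding mult_1 by (intro mult_right_mono powr_mono2) auto
    finally show ?thesis .
  qed
  have meas: "(\<lambda>w::complex. ennreal ((1 - (norm w)\<^sup>2) powr \<alpha>) * indicator unit_disk w) \<in>
      borel_measurable lborel"
    by (intro borel_measurable_times_ennreal borel_measurable_indicator) (simp, measurable)
  have "bergman_mass \<alpha> p (test_function \<alpha> p N a) = (\<integral>\<^sup>+z\<in>\<phi> ` unit_disk. ennreal (u z) \<partial>lborel)"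
    by (simp add: bergman_mass_def u_def im)
  also have "\<dots> \<le> (\<integral>\<^sup>+w\<in>unit_disk. ennreal ((norm (deriv \<phi> w))\<^sup>2 * u (\<phi> w)) \<partial>lborel)"
    using cu hol by (intro nn_integral_holomorphic_image_le) (auto simp: im u_def)
  also have "\<dots> \<le> (\<integral>\<^sup>+w. ennreal (2 powr (real N * p - 4 - 2 * \<alpha>)) *
      (ennreal ((1 - (norm w)\<^sup>2) powr \<alpha>) * indicator unit_disk w) \<partial>lborel)"
    using pt by (intro nn_integral_mono) (auto split: split_indicator intro!: ennreal_leI simp flip:
        ennreal_mult')
  also have "\<dots> = ennreal (2 powr (real N * p - 4 - 2 * \<alpha>)) * bergman_mass \<alpha> p (\<lambda>_. 1)"
    unfolding nn_integral_cmult[OF meas] by (simp add: bergman_mass_def)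
  finally show ?thesis .
qed

section \<open>The operator and the norm in terms of derivatives\<close>

text \<open>The disk is convex, so the integrand has a primitive there, and the integral along the
  segment from 0 is a difference of its values.\<close>

lemma S_op_properties:
  assumes f: "f holomorphic_on unit_disk" and g: "g holomorphic_on unit_disk"
  shows S_op_in_holo_disk: "S_op g f \<in> holo_disk"
    and S_op_0: "S_op g f 0 = 0"
    and deriv_S_op: "z \<in> unit_disk \<Longrightarrow> deriv (S_op g f) z = deriv f z * g z"
proof -
  have "(\<lambda>w. deriv f w * g w) holomorphic_on unit_disk"
    using f g by (intro holomorphic_intros) auto
  then obtain P where "\<And>z. z \<in> unit_disk \<Longrightarrow> (P has_field_derivative deriv f z * g z) (at z within
      unit_disk)"
    by (rule holomorphic_convex_primitive'[rotated 2]) auto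
  then have P: "(P has_field_derivative deriv f z * g z) (at z)" if "z \<in> unit_disk" for z
    using that at_within_open[OF that open_ball] by metis
  have eq: "S_op g f z = P z - P 0" if "z \<in> unit_disk" for z
  proof -
    have "path_image (linepath 0 z) \<subseteq> unit_disk"
      using that closed_segment_subset[of 0 unit_disk z] by simp
    then have "((\<lambda>w. deriv f w * g w) has_contour_integral (P z - P 0)) (linepath 0 z)"
      using contour_integral_primitive[of unit_disk P "\<lambda>w. deriv f w * g w" "linepath 0 z"] P
      by (auto intro: has_field_derivative_at_within)
    then show ?thesis using that by (simp add: S_op_def contour_integral_unique)
  qed
  have der: "(S_op g f has_field_derivative deriv f z * g z) (at z)" if "z \<in> unit_disk" for z
  proof -
    have "((\<lambda>z. P z - P 0) has_field_derivative deriv f z * g z) (at z)"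
      using P[OF that] by (auto intro!: derivative_eq_intros)
    then show ?thesis
      by (rule has_field_derivative_transform_within_open[OF _ open_ball that]) (simp add: eq)
  qed
  then show "z \<in> unit_disk \<Longrightarrow> deriv (S_op g f) z = deriv f z * g z"
    by (rule DERIV_imp_deriv)
  have "S_op g f holomorphic_on unit_disk"
    unfolding holomorphic_on_open[OF open_ball] using der by blast
  then show "S_op g f \<in> holo_disk"
    by (auto simp: holo_disk_def S_op_def)
  show "S_op g f 0 = 0"
    using eq[of 0] by simp
qed

text \<open>\<open>S_op h\<close> applied to the identity integrates \<open>h\<close> itself and
  already has the value 0 outside the disk.\<close>

lemma holo_disk_primitive:
  assumes "h holomorphic_on unit_disk"
  obtains f where "f \<in> holo_disk" "f 0 = 0" "\<And>z. z \<in> unit_disk \<Longrightarrow> deriv f z = h z"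
  using that[of "S_op h (\<lambda>z. z)"] S_op_properties[OF holomorphic_on_ident assms]
  by (simp add: deriv_ident)

text \<open>The p-th power of \<open>dirichlet_norm\<close>, allowed to be infinite; for functions
  in \<open>holo_disk\<close>, lying in the space means that it is finite.\<close>

definition dirichlet_mass :: "real \<Rightarrow> real \<Rightarrow> (complex \<Rightarrow> complex) \<Rightarrow> ennreal" where
  "dirichlet_mass \<alpha> p f = ennreal (norm (f 0) powr p)
      + ennreal (1 / pi) * bergman_mass \<alpha> p (deriv f)"

lemma bergman_mass_measurable:
  assumes "continuous_on unit_disk F"
  shows "(\<lambda>z. ennreal (norm (F z) powr p * (1 - (norm z)\<^sup>2) powr \<alpha>) * indicator unit_disk z)
    \<in> borel_measurable lborel"
proof -
  have "(\<lambda>z. indicator unit_disk z *\<^sub>R F z) \<in> borel_measurable borel"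
    using assms by (intro borel_measurable_continuous_on_indicator) auto
  moreover have "unit_disk \<in> sets borel" by simp
  ultimately have "(\<lambda>z. ennreal (norm (indicator unit_disk z *\<^sub>R F z) powr p * (1 - (norm z)\<^sup>2) powr
      \<alpha>)
      * indicator unit_disk z) \<in> borel_measurable lborel"
    by measurable
  also have "(\<lambda>z. ennreal (norm (indicator unit_disk z *\<^sub>R F z) powr p * (1 - (norm z)\<^sup>2) powr \<alpha>)
      * indicator unit_disk z) = (\<lambda>z. ennreal (norm (F z) powr p * (1 - (norm z)\<^sup>2) powr \<alpha>) *
          indicator unit_disk z)"
    by (auto simp: indicator_def)
  finally show ?thesis .
qed

lemma bergman_mass_cong:
  "(\<And>z. z \<in> unit_disk \<Longrightarrow> F z = G z) \<Longrightarrow> bergman_mass \<alpha> p F = bergman_mass \<alpha> p G"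
  unfolding bergman_mass_def by (intro nn_integral_cong) (auto split: split_indicator)

lemma holo_diskD: "f \<in> holo_disk \<Longrightarrow> f holomorphic_on unit_disk"
  and continuous_deriv_holo_disk: "f \<in> holo_disk \<Longrightarrow> continuous_on unit_disk (deriv f)"
  by (auto simp: holo_disk_def intro!: holomorphic_on_imp_continuous_on holomorphic_deriv)

lemma dirichlet_density_nonneg: "0 \<le> dirichlet_density \<alpha> p f z"
  by (simp add: dirichlet_density_def)

text \<open>Bridge from the Bochner integral of the definitions to \<open>nn_integral\<close>: the
  density is nonnegative and measurable on the disk, so integrability is finiteness of the mass and
  the two integrals agree.\<close>

lemma dirichlet_space_iff:
  "f \<in> dirichlet_space \<alpha> p \<longleftrightarrow> f \<in> holo_disk \<and> dirichlet_mass \<alpha> p f < \<infinity>"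
  and dirichlet_norm_eq:
  "f \<in> dirichlet_space \<alpha> p \<Longrightarrow> dirichlet_norm \<alpha> p f = enn2real (dirichlet_mass \<alpha> p f) powr (1 / p)"
proof -
  have meas: "(\<lambda>z. indicator unit_disk z *\<^sub>R dirichlet_density \<alpha> p f z) \<in> borel_measurable lborel"
      if f: "f \<in> holo_disk"
  proof -
    have "(\<lambda>z. enn2real (ennreal (norm (deriv f z) powr p * (1 - (norm z)\<^sup>2) powr \<alpha>) * indicator
        unit_disk z)) \<in> borel_measurable lborel"
      using bergman_mass_measurable[OF continuous_deriv_holo_disk[OF f]] by measurable
    also have "(\<lambda>z. enn2real (ennreal (norm (deriv f z) powr p * (1 - (norm z)\<^sup>2) powr \<alpha>) *
        indicator unit_disk z))
      = (\<lambda>z. indicator unit_disk z *\<^sub>R dirichlet_density \<alpha> p f z)"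
      by (auto simp: dirichlet_density_def indicator_def)
    finally show ?thesis .
  qed
  have int: "(\<integral>\<^sup>+z. ennreal (indicator unit_disk z *\<^sub>R dirichlet_density \<alpha> p f z) \<partial>lborel) =
      bergman_mass \<alpha> p (deriv f)"
    unfolding bergman_mass_def dirichlet_density_def
    by (intro nn_integral_cong) (auto split: split_indicator)
  have fin: "dirichlet_mass \<alpha> p f < \<infinity> \<longleftrightarrow> bergman_mass \<alpha> p (deriv f) < \<infinity>"
    by (auto simp: dirichlet_mass_def ennreal_mult_less_top less_top[symmetric]
        ennreal_mult_eq_top_iff)
  have "set_integrable lborel unit_disk (dirichlet_density \<alpha> p f) \<longleftrightarrow> bergman_mass \<alpha> p (deriv f) < \<infinity>"
    if f: "f \<in> holo_disk"
  proof -
    have nn: "norm (indicator unit_disk z *\<^sub>R dirichlet_density \<alpha> p f z) =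
        indicator unit_disk z *\<^sub>R dirichlet_density \<alpha> p f z" for z
      using dirichlet_density_nonneg[of \<alpha> p f z] by simp
    show ?thesis
      unfolding set_integrable_def integrable_iff_bounded nn int using meas[OF f] by simp
  qed
  then show iff: "f \<in> dirichlet_space \<alpha> p \<longleftrightarrow> f \<in> holo_disk \<and> dirichlet_mass \<alpha> p f < \<infinity>"
    unfolding dirichlet_space_def fin by auto
  assume f: "f \<in> dirichlet_space \<alpha> p"
  then have "(LINT z:unit_disk|lborel. dirichlet_density \<alpha> p f z) =
      enn2real (bergman_mass \<alpha> p (deriv f))"
    unfolding set_lebesgue_integral_def int[symmetric] using meas dirichlet_density_nonneg
    by (intro integral_eq_nn_integral) (auto simp: iff)
  moreover have "enn2real (dirichlet_mass \<alpha> p f) =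
      norm (f 0) powr p + 1 / pi * enn2real (bergman_mass \<alpha> p (deriv f))"
    using f fin unfolding dirichlet_mass_def iff
    by (subst enn2real_plus) (auto simp: enn2real_mult ennreal_mult_less_top)
  ultimately show "dirichlet_norm \<alpha> p f = enn2real (dirichlet_mass \<alpha> p f) powr (1 / p)"
    by (simp add: dirichlet_norm_def)
qed

text \<open>The constants stay open because three scalar inequalities are fed in: A = B = 1 for p <=
  1, a weighted one for p > 1 whose constants depend on the norms of the two functions, and one with
  a common constant where only some bound matters.\<close>

lemma bergman_mass_add_le:
  assumes F: "continuous_on unit_disk F" and G: "continuous_on unit_disk G"
    and AB: "0 \<le> A" "0 \<le> B" "\<And>x y :: complex. norm (x + y) powr p \<le>
        A * norm x powr p + B * norm y powr p"
  shows "bergman_mass \<alpha> p (\<lambda>z. F z + G z) \<le> ennreal A * bergman_mass \<alpha> p F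
      + ennreal B * bergman_mass \<alpha> p G"
proof -
  let ?w = "\<lambda>F z. ennreal (norm (F z) powr p * (1 - (norm z)\<^sup>2) powr \<alpha>) * indicator unit_disk z"
  have "bergman_mass \<alpha> p (\<lambda>z. F z + G z) \<le> (\<integral>\<^sup>+z. ennreal A * ?w F z + ennreal B * ?w G z \<partial>lborel)"
    unfolding bergman_mass_def
  proof (rule nn_integral_mono)
    fix z
    have "norm (F z + G z) powr p * (1 - (norm z)\<^sup>2) powr \<alpha> \<le>
        (A * norm (F z) powr p + B * norm (G z) powr p) * (1 - (norm z)\<^sup>2) powr \<alpha>"
      by (intro mult_right_mono AB) simp
    then show "ennreal (norm (F z + G z) powr p * (1 - (norm z)\<^sup>2) powr \<alpha>) * indicator unit_disk z
        \<le> ennreal A * ?w F z + ennreal B * ?w G z"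
      using AB by (auto split: split_indicator simp: distrib_right mult.assoc simp flip:
          ennreal_mult' ennreal_plus intro!: ennreal_leI)
  qed
  also have "\<dots> = ennreal A * bergman_mass \<alpha> p F + ennreal B * bergman_mass \<alpha> p G"
    unfolding bergman_mass_def nn_integral_cmult[OF bergman_mass_measurable[OF F], symmetric]
      nn_integral_cmult[OF bergman_mass_measurable[OF G], symmetric]
    by (intro nn_integral_add borel_measurable_times_ennreal borel_measurable_const
        bergman_mass_measurable F G)
  finally show ?thesis .
qed

lemma dirichlet_mass_add_le:
  assumes f: "f \<in> holo_disk" and h: "h \<in> holo_disk"
    and AB: "0 \<le> A" "0 \<le> B" "\<And>x y :: complex. norm (x + y) powr p \<le>
        A * norm x powr p + B * norm y powr p"
  shows "dirichlet_mass \<alpha> p (\<lambda>z. f z + h z) \<le> ennreal A * dirichlet_mass \<alpha> p f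
      + ennreal B * dirichlet_mass \<alpha> p h"
proof -
  have d: "deriv (\<lambda>z. f z + h z) z = deriv f z + deriv h z" if "z \<in> unit_disk" for z
    using holo_diskD[OF f] holo_diskD[OF h] that
    by (intro deriv_add) (auto simp: holomorphic_on_open field_differentiable_def)
  have "bergman_mass \<alpha> p (deriv (\<lambda>z. f z + h z)) = bergman_mass \<alpha> p (\<lambda>z. deriv f z + deriv h z)"
    by (rule bergman_mass_cong) (rule d)
  also have "\<dots> \<le> ennreal A * bergman_mass \<alpha> p (deriv f) + ennreal B * bergman_mass \<alpha> p (deriv h)"
    using f h AB by (intro bergman_mass_add_le continuous_deriv_holo_disk)
  finally have 1: "ennreal (1/pi) * bergman_mass \<alpha> p (deriv (\<lambda>z. f z + h z)) \<le>
      ennreal (1/pi) * (ennreal A * bergman_mass \<alpha> p (deriv f)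
          + ennreal B * bergman_mass \<alpha> p (deriv h))"
    by (intro mult_left_mono) auto
  have "ennreal (norm (f 0 + h 0) powr p) \<le> ennreal A * ennreal (norm (f 0) powr p)
      + ennreal B * ennreal (norm (h 0) powr p)"
    using AB by (simp flip: ennreal_mult' ennreal_plus add: ennreal_leI)
  from add_mono[OF this 1] show ?thesis
    by (simp add: dirichlet_mass_def distrib_left add_ac mult_ac)
qed

section \<open>Negatives and differences of functions\<close>

lemma bergman_mass_minus: "bergman_mass \<alpha> p (\<lambda>z. - F z) = bergman_mass \<alpha> p F"
  by (simp add: bergman_mass_def)

lemma holo_disk_minus: "f \<in> holo_disk \<Longrightarrow> (\<lambda>z. - f z) \<in> holo_disk"
  and holo_disk_diff: "f \<in> holo_disk \<Longrightarrow> h \<in> holo_disk \<Longrightarrow> (\<lambda>z. f z - h z) \<in> holo_disk"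
  by (auto simp: holo_disk_def intro!: holomorphic_intros)

lemma deriv_diff_holo_disk:
  assumes "f \<in> holo_disk" "h \<in> holo_disk" "z \<in> unit_disk"
  shows "deriv (\<lambda>z. f z - h z) z = deriv f z - deriv h z"
  using assms holo_diskD[of f] holo_diskD[of h]
  by (intro deriv_diff) (auto simp: holomorphic_on_open field_differentiable_def)

lemma dirichlet_mass_minus:
  assumes "f \<in> holo_disk"
  shows "dirichlet_mass \<alpha> p (\<lambda>z. - f z) = dirichlet_mass \<alpha> p f"
proof -
  have "bergman_mass \<alpha> p (deriv (\<lambda>z. - f z)) = bergman_mass \<alpha> p (\<lambda>z. - deriv f z)"
    using holo_diskD[OF assms]
    by (intro bergman_mass_cong deriv_minus) (auto simp: holomorphic_on_open
        field_differentiable_def)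
  then show ?thesis by (simp add: dirichlet_mass_def bergman_mass_minus)
qed

text \<open>With s = |x| + |y|, each share t/s lies in [0, 1] and hence is at most (t/s)^p;
  multiplying by s^p and adding the two shares gives the claim.\<close>

lemma powr_add_le:
  fixes x y :: complex and p :: real
  assumes "0 < p" "p \<le> 1"
  shows "norm (x + y) powr p \<le> norm x powr p + norm y powr p"
proof -
  have "norm (x + y) powr p \<le> (norm x + norm y) powr p"
    using assms norm_triangle_ineq by (intro powr_mono2) auto
  also have "\<dots> \<le> norm x powr p + norm y powr p"
  proof (cases "norm x + norm y = 0")
    case False
    define s where "s = norm x + norm y"
    have s: "s > 0" using False by (simp add: s_def add_nonneg_pos
        order.not_eq_order_implies_strict)
    have *: "t / s * s powr p \<le> t powr p" if "0 \<le> t" "t \<le> s" for t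
    proof (cases "t = 0")
      case False
      have "(t / s) powr 1 \<le> (t / s) powr p" using that s False assms by (intro powr_mono') auto
      then show ?thesis using that s False by (simp add: powr_divide field_simps)
    qed simp
    have "s powr p = norm x / s * s powr p + norm y / s * s powr p"
      using s by (simp add: s_def flip: distrib_right add_divide_distrib)
    also have "\<dots> \<le> norm x powr p + norm y powr p"
      by (intro add_mono *) (auto simp: s_def)
    finally show ?thesis by (simp add: s_def)
  qed (use assms in simp)
  finally show ?thesis .
qed

text \<open>Convexity of the p-th power at |x|/s and |y|/t with weights s/(s+t) and t/(s+t). When s
  and t are the norms of two functions, integrating it yields Minkowski's inequality.\<close>

lemma powr_add_le_weighted:
  fixes x y :: complex and p s t :: real
  assumes p: "1 \<le> p" and s: "0 < s" and t: "0 < t"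
  shows "norm (x + y) powr p \<le>
    ((s + t) powr (p - 1) * s powr (1 - p)) * norm x powr p + ((s
        + t) powr (p - 1) * t powr (1 - p)) * norm y powr p"
proof -
  define u where "u = s / (s + t)"
  have u: "0 < u" "u < 1" "1 - u = t / (s + t)" using s t by (auto simp: u_def field_simps)
  have "norm (x + y) \<le> norm x + norm y" by (rule norm_triangle_ineq)
  also have "\<dots> = (s + t) * (u * (norm x / s) + (1 - u) * (norm y / t))"
    unfolding u(3) using s t by (simp add: u_def distrib_left)
  finally have "norm (x + y) powr p \<le> ((s + t) * (u * (norm x / s)
      + (1 - u) * (norm y / t))) powr p"
    using p by (intro powr_mono2) auto
  also have "\<dots> = (s + t) powr p * (u * (norm x / s) + (1 - u) * (norm y / t)) powr p"
    using s t u by (intro powr_mult)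
  also have "\<dots> \<le> (s + t) powr p * (u * (norm x / s) powr p + (1 - u) * (norm y / t) powr p)"
  proof (rule mult_left_mono)
    have "convex_on {0..} (\<lambda>x::real. x powr p)"
    proof (rule convex_onI)
      fix t x y :: real assume *: "0 < t" "t < 1" "x \<in> {0..}" "y \<in> {0..}"
      \<comment> \<open>At the endpoint 0 convexity reduces to r^p <= r for 0 < r < 1.\<close>
      have le: "(r * v) powr p \<le> r * v powr p" if "0 < r" "r < 1" "0 \<le> v" for r v :: real
        using that p powr_mono'[of 1 p r] by (auto simp: powr_mult intro!: mult_right_mono)
      consider "x = 0" | "y = 0" | "x > 0" "y > 0" using * by force
      then show "((1 - t) *\<^sub>R x + t *\<^sub>R y) powr p \<le> (1 - t) * x powr p + t * y powr p"
      proof cases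
        case 3
        then show ?thesis using convex_onD[OF powr_convex[OF p], of t x y] * by simp
      qed (use * le[of t y] le[of "1 - t" x] p in auto)
    qed simp
    then show "(u * (norm x / s) + (1 - u) * (norm y / t)) powr p \<le>
        u * (norm x / s) powr p + (1 - u) * (norm y / t) powr p"
      using u(1,2) s t convex_onD[of "{0..}" "\<lambda>x. x powr p" "1 - u" "norm x / s" "norm y / t"]
          by simp
  qed simp
  also have "\<dots> = ((s + t) powr (p - 1) * s powr (1 - p)) * norm x powr p + ((s
      + t) powr (p - 1) * t powr (1 - p)) * norm y powr p"
    unfolding u(3) using s t by (simp add: u_def powr_divide powr_diff field_simps)
  finally show ?thesis .
qed

section \<open>Sequential compactness in Dirichlet spaces\<close>

text \<open>A sequence in the closure is shadowed by one in \<open>S\<close> at distance below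
  1/(n+1). Where a subsequence of the latter converges, so does the same subsequence of the former,
  and the limit stays in the closure.\<close>

lemma (in Metric_space) compactin_closure_of_sequentially:
  assumes S: "S \<subseteq> M"
  shows "compactin mtopology (mtopology closure_of S) \<longleftrightarrow>
    (\<forall>\<sigma>::nat \<Rightarrow> 'a. range \<sigma> \<subseteq> S \<longrightarrow> (\<exists>l r. strict_mono r \<and> limitin mtopology (\<sigma> \<circ> r) l sequentially))"
    (is "?L \<longleftrightarrow> ?R")
proof
  assume ?L
  moreover have "S \<subseteq> mtopology closure_of S"
    using S by (simp add: closure_of_subset)
  ultimately show ?R
    unfolding compactin_sequentially by (meson order_trans)
next
  assume R: ?R
  show ?L
    unfolding compactin_sequentially
  proof (intro conjI allI impI)
    show "mtopology closure_of S \<subseteq> M" by (metis closure_of_subset_topspace topspace_mtopology)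
    fix \<sigma> :: "nat \<Rightarrow> 'a" assume \<sigma>: "range \<sigma> \<subseteq> mtopology closure_of S"
    have "\<exists>y. y \<in> S \<and> d (\<sigma> n) y < 1 / Suc n" for n
    proof -
      have "\<forall>r>0. \<exists>y\<in>S. y \<in> mball (\<sigma> n) r"
        using \<sigma> by (auto simp: metric_closure_of)
      from this[rule_format, of "1 / Suc n"] obtain y where "y \<in> S" "y \<in> mball (\<sigma> n) (1 / Suc n)"
        by auto
      then show ?thesis by (auto simp: in_mball)
    qed
    then obtain \<tau> where \<tau>: "\<And>n. \<tau> n \<in> S" "\<And>n. d (\<sigma> n) (\<tau> n) < 1 / Suc n" by metis
    then obtain l r where r: "strict_mono r" and l: "limitin mtopology (\<tau> \<circ> r) l sequentially"
      using R by (metis image_subsetI)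
    have lM: "l \<in> M" and lim: "(\<lambda>n. d (\<tau> (r n)) l) \<longlonglongrightarrow> 0"
      using l by (auto simp: limitin_metric_dist_null o_def)
    have \<sigma>M: "\<sigma> n \<in> M" and \<tau>M: "\<tau> n \<in> M" for n
      using \<sigma> \<tau>(1) S closure_of_subset_topspace[of mtopology S] by auto
    have "(\<lambda>n. inverse (real (Suc (r n)))) \<longlonglongrightarrow> 0"
      using LIMSEQ_subseq_LIMSEQ[OF LIMSEQ_inverse_real_of_nat r] by (simp add: o_def)
    then have "(\<lambda>n. inverse (real (Suc (r n))) + d (\<tau> (r n)) l) \<longlonglongrightarrow> 0"
      using lim tendsto_add_zero by blast
    then have "(\<lambda>n. d (\<sigma> (r n)) l) \<longlonglongrightarrow> 0"
    proof (rule Lim_null_comparison[rotated])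
      show "\<forall>\<^sub>F n in sequentially. norm (d (\<sigma> (r n)) l) \<le>
          inverse (real (Suc (r n))) + d (\<tau> (r n)) l"
      proof (intro always_eventually allI)
        fix n
        have "d (\<sigma> (r n)) l \<le> d (\<sigma> (r n)) (\<tau> (r n)) + d (\<tau> (r n)) l"
          using \<sigma>M \<tau>M lM by (rule triangle)
        then show "norm (d (\<sigma> (r n)) l) \<le> inverse (real (Suc (r n))) + d (\<tau> (r n)) l"
          using \<tau>(2)[of "r n"] by (simp add: inverse_eq_divide)
      qed
    qed
    then have "limitin mtopology (\<sigma> \<circ> r) l sequentially"
      using lM \<sigma>M by (simp add: limitin_metric_dist_null o_def)
    moreover have "l \<in> mtopology closure_of S"
    proof -
      have "\<exists>y\<in>S. y \<in> mball l e" if "e > 0" for e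
      proof -
        have "\<exists>n. d (\<tau> (r n)) l < e"
          using order_tendstoD(2)[OF lim that] eventually_happens trivial_limit_sequentially
              by blast
        then show ?thesis using \<tau>(1) \<tau>M lM by (metis commute in_mball)
      qed
      then show ?thesis using lM by (auto simp: metric_closure_of)
    qed
    ultimately show "\<exists>l r. l \<in> mtopology closure_of S \<and> strict_mono r \<and> limitin mtopology (\<sigma> \<circ> r) l
        sequentially"
      using r by blast
  qed
qed

text \<open>The point estimate makes the derivative vanish at every point of the disk, not just
  almost everywhere. So \<open>f\<close> is constant there, equal to \<open>f 0\<close> = 0, and
  outside it vanishes by the convention of \<open>holo_disk\<close>.\<close>

lemma dirichlet_mass_eq_0_iff:
  assumes p: "0 < p" and f: "f \<in> holo_disk"
  shows "dirichlet_mass \<alpha> p f = 0 \<longleftrightarrow> f = (\<lambda>_. 0)"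
proof
  assume "dirichlet_mass \<alpha> p f = 0"
  then have f0: "f 0 = 0" and B: "bergman_mass \<alpha> p (deriv f) = 0"
    by (auto simp: dirichlet_mass_def)
  obtain C where C: "C > 0" "\<And>F a. F holomorphic_on unit_disk \<Longrightarrow> a \<in> unit_disk \<Longrightarrow>
       ennreal (norm (F a) powr p * (1 - (norm a)\<^sup>2) powr (\<alpha> + 2)) \<le> ennreal C * bergman_mass \<alpha> p F"
    using bergman_point_estimate[OF p] by blast
  have hol: "f holomorphic_on unit_disk" using f by (rule holo_diskD)
  have d0: "deriv f z = 0" if z: "z \<in> unit_disk" for z
  proof -
    have "1 - (norm z)\<^sup>2 > 0" using z weight_pos by simp
    moreover have "ennreal (norm (deriv f z) powr p * (1 - (norm z)\<^sup>2) powr (\<alpha> + 2)) \<le> 0"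
      using C(2)[OF holomorphic_deriv[OF hol open_ball] z] B by simp
    ultimately show ?thesis by (auto simp: ennreal_eq_0_iff mult_le_0_iff)
  qed
  have "f z = 0" if z: "z \<in> unit_disk" for z
  proof -
    have "(f has_field_derivative 0) (at x within unit_disk)" if "x \<in> unit_disk" for x
      using holomorphic_derivI[OF hol open_ball that] d0[OF that] by simp
    then obtain c where "\<And>x. x \<in> unit_disk \<Longrightarrow> f x = c"
      using has_field_derivative_zero_constant[of unit_disk f] by auto
    then show ?thesis using z f0 by (metis centre_in_ball zero_less_one)
  qed
  then show "f = (\<lambda>_. 0)" using f by (auto simp: holo_disk_def)
qed (use p in \<open>simp add: dirichlet_mass_def bergman_mass_def\<close>)

lemma powr_add_le_quasi:
  fixes p :: real
  assumes "0 < p"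
  obtains A where "0 \<le> A" "\<And>x y :: complex. norm (x + y) powr p \<le>
      A * norm x powr p + A * norm y powr p"
proof (cases "p \<le> 1")
  case True
  then show ?thesis using that[of 1] powr_add_le assms by simp
next
  case False
  then show ?thesis using that[of "2 powr (p - 1)"] powr_add_le_weighted[of p 1 1] by simp
qed

section \<open>The metric given by a power of the quasi-norm\<close>

lemma dirichlet_space_diff:
  assumes p: "0 < p" and f: "f \<in> dirichlet_space \<alpha> p" and h: "h \<in> dirichlet_space \<alpha> p"
  shows "(\<lambda>z. f z - h z) \<in> dirichlet_space \<alpha> p"
proof -
  have fh: "f \<in> holo_disk" "h \<in> holo_disk" using f h by (auto simp: dirichlet_space_iff)
  obtain A where A: "0 \<le> A" "\<And>x y :: complex. norm (x + y) powr p \<le>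
      A * norm x powr p + A * norm y powr p"
    using powr_add_le_quasi[OF p] by blast
  have "dirichlet_mass \<alpha> p (\<lambda>z. f z + - h z) \<le> ennreal A * dirichlet_mass \<alpha> p f
      + ennreal A * dirichlet_mass \<alpha> p (\<lambda>z. - h z)"
    using fh A by (intro dirichlet_mass_add_le holo_disk_minus)
  also have "\<dots> < \<infinity>"
    using f h fh by (simp add: dirichlet_space_iff dirichlet_mass_minus ennreal_mult_less_top)
  finally show ?thesis using holo_disk_diff[OF fh] by (simp add: dirichlet_space_iff)
qed

text \<open>The exponent makes the (quasi-)norm subadditive in both ranges of \<open>p\<close>.\<close>

definition dirichlet_gauge :: "real \<Rightarrow> real \<Rightarrow> (complex \<Rightarrow> complex) \<Rightarrow> real" where
  "dirichlet_gauge \<alpha> p f = enn2real (dirichlet_mass \<alpha> p f) powr (min 1 p / p)"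

text \<open>For p <= 1 the gauge is the mass, which is subadditive. For p > 1 it is the norm: with
  the two norms s and t as weights, s^(1-p) s^p = s collapses the bound on the mass of the sum to (s
  + t)^p.\<close>

lemma dirichlet_gauge_add_le:
  assumes p: "0 < p" and f: "f \<in> dirichlet_space \<alpha> p" and h: "h \<in> dirichlet_space \<alpha> p"
  shows "dirichlet_gauge \<alpha> p (\<lambda>z. f z + h z) \<le> dirichlet_gauge \<alpha> p f + dirichlet_gauge \<alpha> p h"
proof -
  have fh: "f \<in> holo_disk" "h \<in> holo_disk" and fin: "dirichlet_mass \<alpha> p f < \<infinity>" "dirichlet_mass \<alpha> p h <
      \<infinity>"
    using f h by (auto simp: dirichlet_space_iff)
  show ?thesis
  proof (cases "p \<le> 1")
    case True
    have "dirichlet_mass \<alpha> p (\<lambda>z. f z + h z) \<le> dirichlet_mass \<alpha> p f + dirichlet_mass \<alpha> p h"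
      using dirichlet_mass_add_le[OF fh, of 1 1 p \<alpha>] powr_add_le[OF p True] by simp
    then have "enn2real (dirichlet_mass \<alpha> p (\<lambda>z. f z + h z)) \<le>
        enn2real (dirichlet_mass \<alpha> p f) + enn2real (dirichlet_mass \<alpha> p h)"
      using fin by (subst enn2real_plus[symmetric]) (auto intro!: enn2real_mono)
    then show ?thesis using True p by (simp add: dirichlet_gauge_def)
  next
    case False
    define s where "s = dirichlet_gauge \<alpha> p f"
    define t where "t = dirichlet_gauge \<alpha> p h"
    have gauge: "dirichlet_gauge \<alpha> p k = enn2real (dirichlet_mass \<alpha> p k) powr (1 / p)" for k
      using False by (simp add: dirichlet_gauge_def)
    have mass: "dirichlet_mass \<alpha> p k = ennreal (dirichlet_gauge \<alpha> p k powr p)"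
        if "dirichlet_mass \<alpha> p k < \<infinity>" for k
      using that p by (simp add: gauge powr_powr)
    have gauge_pos: "dirichlet_gauge \<alpha> p k > 0"
        if "k \<in> holo_disk" "k \<noteq> (\<lambda>_. 0)" "dirichlet_mass \<alpha> p k < \<infinity>" for k
    proof -
      have "dirichlet_mass \<alpha> p k \<noteq> 0" using that p dirichlet_mass_eq_0_iff by blast
      then show ?thesis using that(3) by (auto simp: gauge enn2real_eq_0_iff)
    qed
    show ?thesis
    \<comment> \<open>The weights have to be positive, so a zero summand is set aside.\<close>
    proof (cases "f = (\<lambda>_. 0) \<or> h = (\<lambda>_. 0)")
      case True
      then show ?thesis by (auto simp: gauge)
    next
      case nz: False
      then have s: "s > 0" and t: "t > 0" using gauge_pos fh fin by (auto simp: s_def t_def)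
      have "dirichlet_mass \<alpha> p (\<lambda>z. f z + h z) \<le>
          ennreal ((s + t) powr (p - 1) * s powr (1 - p)) * ennreal (s powr p) +
          ennreal ((s + t) powr (p - 1) * t powr (1 - p)) * ennreal (t powr p)"
        unfolding s_def t_def mass[OF fin(1), symmetric] mass[OF fin(2), symmetric]
        using False s t by (intro dirichlet_mass_add_le fh powr_add_le_weighted) (auto simp: s_def
            t_def)
      also have "\<dots> = ennreal ((s + t) powr (p - 1) * (s powr (1 - p) * s powr p
          + t powr (1 - p) * t powr p))"
        by (simp add: distrib_left mult.assoc flip: ennreal_mult' ennreal_plus)
      also have "s powr (1 - p) * s powr p + t powr (1 - p) * t powr p = (s + t) powr 1"
        using s t by (simp flip: powr_add)
      also have "(s + t) powr (p - 1) * (s + t) powr 1 = (s + t) powr p"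
        unfolding powr_add[symmetric] by simp
      finally have "enn2real (dirichlet_mass \<alpha> p (\<lambda>z. f z + h z)) \<le> (s + t) powr p"
        by (intro enn2real_leI) auto
      then have "enn2real (dirichlet_mass \<alpha> p (\<lambda>z. f z + h z)) powr (1 / p) \<le>
          ((s + t) powr p) powr (1 / p)"
        using p by (intro powr_mono2) auto
      also have "\<dots> = s + t" using p s t by (simp add: powr_powr)
      finally show ?thesis by (simp add: gauge s_def t_def)
    qed
  qed
qed

text \<open>
  The value off the space is 0 because symmetry must hold for all functions, and \<^term>\<open>deriv f z\<close> is
  arbitrary where \<open>f\<close> is not differentiable.
\<close>

definition dirichlet_dist :: "real \<Rightarrow> real \<Rightarrow> (complex \<Rightarrow> complex) \<Rightarrow> (complex \<Rightarrow> complex) \<Rightarrow> real" where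
  "dirichlet_dist \<alpha> p f h =
     (if f \<in> dirichlet_space \<alpha> p \<and> h \<in> dirichlet_space \<alpha> p then dirichlet_gauge \<alpha> p (\<lambda>z. f z - h z)
         else 0)"

lemma Metric_space_dirichlet:
  assumes p: "0 < p"
  shows "Metric_space (dirichlet_space \<alpha> p) (dirichlet_dist \<alpha> p)"
proof
  fix f h :: "complex \<Rightarrow> complex"
  show "0 \<le> dirichlet_dist \<alpha> p f h" by (simp add: dirichlet_dist_def dirichlet_gauge_def)
  show "dirichlet_dist \<alpha> p f h = dirichlet_dist \<alpha> p h f"
  proof (cases "f \<in> dirichlet_space \<alpha> p \<and> h \<in> dirichlet_space \<alpha> p")
    case True
    then have "(\<lambda>z. f z - h z) \<in> holo_disk" by (auto simp: dirichlet_space_iff intro: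
        holo_disk_diff)
    from dirichlet_mass_minus[OF this, of \<alpha> p] show ?thesis
      by (simp add: dirichlet_dist_def dirichlet_gauge_def conj_commute)
  qed (auto simp: dirichlet_dist_def)
next
  fix f h assume f: "f \<in> dirichlet_space \<alpha> p" and h: "h \<in> dirichlet_space \<alpha> p"
  have d: "(\<lambda>z. f z - h z) \<in> dirichlet_space \<alpha> p" using dirichlet_space_diff[OF p f h] .
  have "dirichlet_dist \<alpha> p f h = 0 \<longleftrightarrow> dirichlet_mass \<alpha> p (\<lambda>z. f z - h z) = 0"
    using d f h by (auto simp: dirichlet_dist_def dirichlet_gauge_def dirichlet_space_iff
        enn2real_eq_0_iff)
  also have "\<dots> \<longleftrightarrow> (\<lambda>z. f z - h z) = (\<lambda>_. 0)"
    using d p by (intro dirichlet_mass_eq_0_iff) (auto simp: dirichlet_space_iff)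
  finally show "dirichlet_dist \<alpha> p f h = 0 \<longleftrightarrow> f = h" by (auto simp: fun_eq_iff)
next
  fix f h k assume "f \<in> dirichlet_space \<alpha> p" "h \<in> dirichlet_space \<alpha> p" "k \<in> dirichlet_space \<alpha> p"
  then show "dirichlet_dist \<alpha> p f k \<le> dirichlet_dist \<alpha> p f h + dirichlet_dist \<alpha> p h k"
    using dirichlet_gauge_add_le[OF p dirichlet_space_diff[OF p, of f \<alpha> h] dirichlet_space_diff[OF
        p, of h \<alpha> k]]
    by (simp add: dirichlet_dist_def)
qed

lemma dirichlet_dist_eq_norm:
  assumes p: "0 < p" and f: "f \<in> dirichlet_space \<alpha> p" and h: "h \<in> dirichlet_space \<alpha> p"
  shows "dirichlet_dist \<alpha> p f h = dirichlet_norm \<alpha> p (\<lambda>z. f z - h z) powr min 1 p"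
  using dirichlet_norm_eq[OF dirichlet_space_diff[OF assms]] f h
  by (simp add: dirichlet_dist_def dirichlet_gauge_def powr_powr)

text \<open>On the space the distance is the power min(1, p) of the quasi-norm of the difference.
  This power is strictly increasing and vanishes at 0, so the two kinds of balls differ only by a
  change of radius.\<close>

lemma dirichlet_topology_eq_mtopology:
  assumes p: "0 < p"
  shows "dirichlet_topology \<alpha> p = Metric_space.mtopology (dirichlet_space \<alpha> p) (dirichlet_dist \<alpha> p)"
proof -
  interpret Metric_space "dirichlet_space \<alpha> p" "dirichlet_dist \<alpha> p"
    using p by (rule Metric_space_dirichlet)
  let ?N = "\<lambda>f h. dirichlet_norm \<alpha> p (\<lambda>z. h z - f z)"
  have d: "dirichlet_dist \<alpha> p f h = ?N f h powr min 1 p"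
      if "f \<in> dirichlet_space \<alpha> p" "h \<in> dirichlet_space \<alpha> p" for f h
    using dirichlet_dist_eq_norm[OF p that(2,1)] commute by metis
  have N0: "?N f h \<ge> 0" for f h by (simp add: dirichlet_norm_def)
  have iff: "(\<exists>e>0. \<forall>h\<in>dirichlet_space \<alpha> p. ?N f h < e \<longrightarrow> h \<in> U) \<longleftrightarrow> (\<exists>r>0. mball f r \<subseteq> U)"
    if f: "f \<in> dirichlet_space \<alpha> p" for f U
  proof
    assume "\<exists>e>0. \<forall>h\<in>dirichlet_space \<alpha> p. ?N f h < e \<longrightarrow> h \<in> U"
    then obtain e where e: "e > 0" "\<And>h. h \<in> dirichlet_space \<alpha> p \<Longrightarrow> ?N f h < e \<Longrightarrow> h \<in> U" by blast
    have "mball f (e powr min 1 p) \<subseteq> U"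
    proof
      fix h assume "h \<in> mball f (e powr min 1 p)"
      then have h: "h \<in> dirichlet_space \<alpha> p" "?N f h powr min 1 p < e powr min 1 p"
        using d[OF f] by auto
      then have "?N f h < e"
        using p e(1) N0 powr_mono2[of "min 1 p" e "?N f h"] by (cases "e \<le> ?N f h") auto
      then show "h \<in> U" using e(2) h(1) by blast
    qed
    then show "\<exists>r>0. mball f r \<subseteq> U" using e(1) by (intro exI[of _ "e powr min 1 p"]) auto
  next
    assume "\<exists>r>0. mball f r \<subseteq> U"
    then obtain r where r: "r > 0" "mball f r \<subseteq> U" by blast
    show "\<exists>e>0. \<forall>h\<in>dirichlet_space \<alpha> p. ?N f h < e \<longrightarrow> h \<in> U"
    proof (intro exI[of _ "r powr (1 / min 1 p)"] conjI ballI impI)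
      fix h assume h: "h \<in> dirichlet_space \<alpha> p" "?N f h < r powr (1 / min 1 p)"
      have "?N f h powr min 1 p < (r powr (1 / min 1 p)) powr min 1 p"
        using h(2) p N0 by (intro powr_less_mono2) auto
      also have "\<dots> = r" using r p by (simp add: powr_powr)
      finally show "h \<in> U" using r(2) f h(1) d[OF f h(1)] by (auto simp: subset_iff)
    qed (use r in simp)
  qed
  show ?thesis
    unfolding topology_eq openin_dirichlet_topology openin_mtopology dirichlet_open_def
    using iff by (meson subsetD)
qed

text \<open>Both directions of the theorem use compactness in this form. The gauge is a positive
  power of the mass, so metric convergence means that the masses tend to 0. The limit ranges over
  the whole space, since only the closure of \<open>S\<close> is compact.\<close>

lemma relatively_compact_in_dirichlet_iff:
  assumes p: "0 < p" and S: "S \<subseteq> dirichlet_space \<alpha> p"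
  shows "relatively_compact_in (dirichlet_topology \<alpha> p) S \<longleftrightarrow>
    (\<forall>\<sigma>::nat \<Rightarrow> _. range \<sigma> \<subseteq> S \<longrightarrow> (\<exists>l\<in>dirichlet_space \<alpha> p. \<exists>r. strict_mono r \<and>
       (\<lambda>n. dirichlet_mass \<alpha> p (\<lambda>z. \<sigma> (r n) z - l z)) \<longlonglongrightarrow> 0))"
proof -
  interpret Metric_space "dirichlet_space \<alpha> p" "dirichlet_dist \<alpha> p"
    using p by (rule Metric_space_dirichlet)
  define e where "e = min 1 p / p"
  have e: "e > 0" using p by (simp add: e_def)
  have lim: "limitin mtopology (\<sigma> \<circ> r) l sequentially \<longleftrightarrow> l \<in> dirichlet_space \<alpha> p \<and>
      (\<lambda>n. dirichlet_mass \<alpha> p (\<lambda>z. \<sigma> (r n) z - l z)) \<longlonglongrightarrow> 0"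
    if \<sigma>: "range \<sigma> \<subseteq> S" for \<sigma> :: "nat \<Rightarrow> _" and r l
  proof (cases "l \<in> dirichlet_space \<alpha> p")
    case l: True
    define m where "m n = dirichlet_mass \<alpha> p (\<lambda>z. \<sigma> (r n) z - l z)" for n
    have \<sigma>': "\<sigma> n \<in> dirichlet_space \<alpha> p" for n using \<sigma> S by auto
    have fin: "m n < \<infinity>" for n
      using dirichlet_space_diff[OF p \<sigma>' l] by (simp add: dirichlet_space_iff m_def)
    have d: "dirichlet_dist \<alpha> p (\<sigma> (r n)) l = enn2real (m n) powr e" for n
      using \<sigma>' l by (simp add: dirichlet_dist_def dirichlet_gauge_def m_def e_def)
    have "(\<lambda>n. enn2real (m n) powr e) \<longlonglongrightarrow> 0 \<longleftrightarrow> m \<longlonglongrightarrow> 0"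
    proof
      assume "(\<lambda>n. enn2real (m n) powr e) \<longlonglongrightarrow> 0"
      then have "(\<lambda>n. (enn2real (m n) powr e) powr (1 / e)) \<longlonglongrightarrow> 0"
        using e by (rule_tac tendsto_zero_powrI[OF _ tendsto_const]) auto
      then have "(\<lambda>n. enn2real (m n)) \<longlonglongrightarrow> 0" using e by (simp add: powr_powr)
      then have "(\<lambda>n. ennreal (enn2real (m n))) \<longlonglongrightarrow> ennreal 0" by (rule tendsto_ennrealI)
      then show "m \<longlonglongrightarrow> 0" using fin by simp
    next
      assume "m \<longlonglongrightarrow> 0"
      then have "(\<lambda>n. enn2real (m n)) \<longlonglongrightarrow> enn2real 0" by (intro tendsto_enn2real) auto
      then show "(\<lambda>n. enn2real (m n) powr e) \<longlonglongrightarrow> 0"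
        using e by (rule_tac tendsto_zero_powrI[OF _ tendsto_const]) auto
    qed
    then show ?thesis using l \<sigma>' by (simp add: limitin_metric_dist_null d m_def[abs_def] o_def)
  qed (simp add: limitin_metric_dist_null)
  have "(\<exists>l r. strict_mono r \<and> limitin mtopology (\<sigma> \<circ> r) l sequentially) \<longleftrightarrow>
      (\<exists>l\<in>dirichlet_space \<alpha> p. \<exists>r. strict_mono r \<and>
        (\<lambda>n. dirichlet_mass \<alpha> p (\<lambda>z. \<sigma> (r n) z - l z)) \<longlonglongrightarrow> 0)"
    if "range \<sigma> \<subseteq> S" for \<sigma> :: "nat \<Rightarrow> _"
    unfolding lim[OF that] by blast
  then show ?thesis
    unfolding relatively_compact_in_def dirichlet_topology_eq_mtopology[OF p] topspace_mtopology
      compactin_closure_of_sequentially[OF S]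
    using S by simp
qed

section \<open>Sufficiency\<close>

text \<open>The annuli r < |z| < 1 form a base of the filter, so "eventually" means "on some
  annulus".\<close>

lemma smallo_unit_disk_iff:
  fixes g :: "complex \<Rightarrow> complex"
  shows "(\<lambda>z. norm (g z)) \<in> o[filtercomap norm (at_left 1)](\<lambda>z. (1 - (norm z)\<^sup>2) powr \<gamma>) \<longleftrightarrow>
    (\<forall>c>0. \<exists>r<1. \<forall>z. r < norm z \<and> norm z < 1 \<longrightarrow> norm (g z) \<le> c * (1 - (norm z)\<^sup>2) powr \<gamma>)"
proof -
  have ev: "eventually P (filtercomap norm (at_left 1)) \<longleftrightarrow> (\<exists>r<1. \<forall>z. r < norm z \<and> norm z < 1 \<longrightarrow> P z)"
    for P :: "complex \<Rightarrow> bool"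
  proof
    assume "eventually P (filtercomap norm (at_left 1))"
    then obtain Q where Q: "eventually Q (at_left (1::real))" "\<And>z. Q (norm z) \<Longrightarrow> P z"
      by (auto simp: eventually_filtercomap)
    then show "\<exists>r<1. \<forall>z. r < norm z \<and> norm z < 1 \<longrightarrow> P z"
      using eventually_at_left[of 0 "1::real" Q] by auto
  next
    assume "\<exists>r<1. \<forall>z. r < norm z \<and> norm z < 1 \<longrightarrow> P z"
    then obtain r where r: "r < 1" "\<And>z. r < norm z \<Longrightarrow> norm z < 1 \<Longrightarrow> P z" by blast
    have "eventually (\<lambda>x. r < x \<and> x < 1) (at_left (1::real))"
      using r(1) eventually_at_left[of 0 "1::real" "\<lambda>x. r < x \<and> x < 1"] by auto
    then show "eventually P (filtercomap norm (at_left 1))"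
      unfolding eventually_filtercomap using r(2) by blast
  qed
  show ?thesis
    unfolding smallo_def by (simp add: ev)
qed

text \<open>Near the circle the hypothesis with c = 1 gives the bound; on the remaining closed disk
  the quotient is continuous and hence bounded. This global constant gives the mapping
  property.\<close>

lemma smallo_imp_weight_bound:
  fixes g :: "complex \<Rightarrow> complex"
  assumes g: "g holomorphic_on unit_disk"
    and small: "\<And>c. 0 < c \<Longrightarrow> \<exists>r<1. \<forall>z. r < norm z \<and> norm z < 1 \<longrightarrow>
        norm (g z) \<le> c * (1 - (norm z)\<^sup>2) powr \<gamma>"
  obtains c where "0 \<le> c" "\<And>z. z \<in> unit_disk \<Longrightarrow> norm (g z) \<le> c * (1 - (norm z)\<^sup>2) powr \<gamma>"
proof -
  obtain r where r: "r < 1" "\<And>z. r < norm z \<Longrightarrow> norm z < 1 \<Longrightarrow> norm (g z) \<le> 1 * (1 - (norm z)\<^sup>2) powr \<gamma>"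
    using small[of 1] by auto
  \<comment> \<open>\<open>r\<close> may be negative; the closed disk is then empty and the argument
    stays valid.\<close>
  have sub: "cball 0 r \<subseteq> unit_disk" using r(1) by auto
  have w: "1 - (norm z)\<^sup>2 \<noteq> 0" if "z \<in> cball 0 r" for z :: complex
    using weight_pos[of z] that r(1) by simp
  have "continuous_on (cball 0 r) (\<lambda>z. norm (g z) * (1 - (norm z)\<^sup>2) powr (- \<gamma>))"
    using sub r(1) by (intro continuous_intros continuous_on_subset[OF
        holomorphic_on_imp_continuous_on[OF g]])
      (use w in auto)
  then have "bounded ((\<lambda>z. norm (g z) * (1 - (norm z)\<^sup>2) powr (- \<gamma>)) ` cball 0 r)"
    by (intro compact_imp_bounded compact_continuous_image) auto
  then obtain b where b: "\<And>z. z \<in> cball 0 r \<Longrightarrow> norm (g z) * (1 - (norm z)\<^sup>2) powr (- \<gamma>) \<le> b"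
    by (fastforce simp: bounded_real abs_mult)
  show ?thesis
  proof (rule that[of "max 1 b"])
    fix z assume z: "z \<in> unit_disk"
    have d: "1 - (norm z)\<^sup>2 > 0" using z weight_pos by simp
    show "norm (g z) \<le> max 1 b * (1 - (norm z)\<^sup>2) powr \<gamma>"
    proof (cases "norm z \<le> r")
      case True
      then have "norm (g z) \<le> b * (1 - (norm z)\<^sup>2) powr \<gamma>"
        using b[of z] d by (simp add: powr_minus field_simps)
      also have "\<dots> \<le> max 1 b * (1 - (norm z)\<^sup>2) powr \<gamma>" by (intro mult_right_mono) auto
      finally show ?thesis .
    next
      case False
      then have "norm (g z) \<le> 1 * (1 - (norm z)\<^sup>2) powr \<gamma>" using r(2) z by auto
      also have "\<dots> \<le> max 1 b * (1 - (norm z)\<^sup>2) powr \<gamma>" by (intro mult_right_mono) auto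
      finally show ?thesis .
    qed
  qed simp
qed

text \<open>Everything happens at one point, with \<open>d\<close> in the role of 1 - |z|^2 and
  \<open>K\<close> bounding |h|^p d^(\<alpha> + 2). The cancellation is -(\<alpha> + 2)(q - p)/p +
  \<gamma> q + \<beta> = \<alpha>, where \<gamma> is the exponent in the bound for
  \<open>g\<close>.\<close>

lemma weighted_product_le:
  fixes h g :: complex and p q \<alpha> \<beta> c d K :: real
  assumes pq: "0 < p" "p < q" and d: "0 < d" and c: "0 \<le> c" and K: "0 \<le> K"
    and h: "norm h powr p * d powr (\<alpha> + 2) \<le> K"
    and g: "norm g \<le> c * d powr ((2 + \<alpha>) / p - (2 + \<beta>) / q)"
  shows "norm (h * g) powr q * d powr \<beta> \<le> K powr ((q - p) / p) * c powr q * (norm h powr p * d powr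
      \<alpha>)"
proof -
  let ?e = "(q - p) / p" and ?\<gamma> = "(2 + \<alpha>) / p - (2 + \<beta>) / q"
  have "norm h powr (q - p) = (norm h powr p) powr ?e"
    using pq by (simp add: powr_powr)
  also have "\<dots> \<le> (K * d powr (- (\<alpha> + 2))) powr ?e"
    using pq h d unfolding powr_minus by (intro powr_mono2) (auto simp: field_simps)
  also have "\<dots> = K powr ?e * d powr (- (\<alpha> + 2) * ?e)"
    using K by (simp add: powr_mult powr_powr)
  finally have 1: "norm h powr (q - p) \<le> K powr ?e * d powr (- (\<alpha> + 2) * ?e)" .
  have "norm g powr q \<le> (c * d powr ?\<gamma>) powr q"
    using pq g by (intro powr_mono2) auto
  also have "\<dots> = c powr q * d powr (?\<gamma> * q)"
    using c by (simp add: powr_mult powr_powr)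
  finally have 2: "norm g powr q \<le> c powr q * d powr (?\<gamma> * q)" .
  have "norm (h * g) powr q * d powr \<beta> = norm h powr p * (norm h powr (q - p) * norm g powr q) * d
      powr \<beta>"
    by (simp add: norm_mult powr_mult flip: powr_add)
  also have "\<dots> \<le> norm h powr p * ((K powr ?e * d powr (- (\<alpha>
      + 2) * ?e)) * (c powr q * d powr (?\<gamma> * q))) * d powr \<beta>"
    by (intro mult_right_mono mult_left_mono mult_mono 1 2) auto
  also have "\<dots> = K powr ?e * c powr q * (norm h powr p * (d powr (- (\<alpha>
      + 2) * ?e) * d powr (?\<gamma> * q) * d powr \<beta>))"
    by (simp add: mult_ac)
  also have "d powr (- (\<alpha> + 2) * ?e) * d powr (?\<gamma> * q) * d powr \<beta> = d powr \<alpha>"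
  proof -
    have "- (\<alpha> + 2) * ?e + ?\<gamma> * q + \<beta> = \<alpha>" using pq by (simp add: field_simps)
    then show ?thesis unfolding powr_add[symmetric] by simp
  qed
  finally show ?thesis .
qed

lemma bergman_mass_mono_cmult:
  assumes "continuous_on unit_disk G" "0 \<le> K"
    and "\<And>z. z \<in> unit_disk \<Longrightarrow>
      norm (F z) powr q * (1 - (norm z)\<^sup>2) powr \<beta> \<le>
          K * (norm (G z) powr p * (1 - (norm z)\<^sup>2) powr \<alpha>)"
  shows "bergman_mass \<beta> q F \<le> ennreal K * bergman_mass \<alpha> p G"
proof -
  have "bergman_mass \<beta> q F \<le> (\<integral>\<^sup>+z. ennreal K * (ennreal (norm (G z) powr p * (1 - (norm z)\<^sup>2) powr
      \<alpha>) * indicator unit_disk z) \<partial>lborel)"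
    unfolding bergman_mass_def using assms(2,3)
    by (intro nn_integral_mono) (auto split: split_indicator intro!: ennreal_leI simp flip:
        ennreal_mult')
  then show ?thesis
    unfolding nn_integral_cmult[OF bergman_mass_measurable[OF assms(1)]]
        by (simp add: bergman_mass_def)
qed

text \<open>Convergence on compact subsets gives no control of the integral near the circle; Fatou's
  lemma does.\<close>

lemma bergman_mass_liminf_le:
  assumes F: "\<And>n. continuous_on unit_disk (F n)" and G: "\<And>z. z \<in> unit_disk \<Longrightarrow> (\<lambda>n. F n z) \<longlonglongrightarrow> G z"
    and L: "\<And>n. bergman_mass \<alpha> p (F n) \<le> L" and p: "0 < p"
  shows "bergman_mass \<alpha> p G \<le> L"
proof -
  let ?w = "\<lambda>F z. ennreal (norm (F z) powr p * (1 - (norm z)\<^sup>2) powr \<alpha>) * indicator unit_disk z"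
  have "?w G z = liminf (\<lambda>n. ?w (F n) z)" for z
  proof (cases "z \<in> unit_disk")
    case True
    have "(\<lambda>n. ennreal (norm (F n z) powr p * (1 - (norm z)\<^sup>2) powr \<alpha>)) \<longlonglongrightarrow>
        ennreal (norm (G z) powr p * (1 - (norm z)\<^sup>2) powr \<alpha>)"
      using p by (intro tendsto_ennrealI tendsto_mult tendsto_powr' tendsto_norm G True
          tendsto_const) auto
    from lim_imp_Liminf[OF trivial_limit_sequentially this] True show ?thesis by simp
  qed (simp add: Liminf_const)
  then have "bergman_mass \<alpha> p G = (\<integral>\<^sup>+z. liminf (\<lambda>n. ?w (F n) z) \<partial>lborel)"
    by (simp add: bergman_mass_def)
  also have "\<dots> \<le> liminf (\<lambda>n. bergman_mass \<alpha> p (F n))"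
    unfolding bergman_mass_def by (intro nn_integral_liminf bergman_mass_measurable F)
  also have "\<dots> \<le> L"
    using L by (intro Liminf_le) auto
  finally show ?thesis .
qed

section \<open>Bounded sets and images in terms of masses\<close>

lemma dirichlet_bounded_imp_mass_bound:
  assumes p: "0 < p" and B: "dirichlet_bounded \<alpha> p B"
  obtains L where "0 \<le> L" "\<And>f. f \<in> B \<Longrightarrow> bergman_mass \<alpha> p (deriv f) \<le> ennreal L"
proof -
  obtain M where M: "\<And>f. f \<in> B \<Longrightarrow> dirichlet_norm \<alpha> p f \<le> M" and sub: "B \<subseteq> dirichlet_space \<alpha> p"
    using B by (auto simp: dirichlet_bounded_def)
  show ?thesis
  \<comment> \<open>The factor pi undoes the normalization in the mass; \<open>max\<close> covers an
    empty \<open>B\<close>, for which \<open>M\<close> may be negative.\<close>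
  proof (rule that[of "pi * (max M 0) powr p"])
    fix f assume f: "f \<in> B"
    then have fs: "f \<in> dirichlet_space \<alpha> p" using sub by auto
    have "enn2real (dirichlet_mass \<alpha> p f) = dirichlet_norm \<alpha> p f powr p"
      using p by (simp add: dirichlet_norm_eq[OF fs] powr_powr)
    also have "\<dots> \<le> (max M 0) powr p"
      using M[OF f] p by (intro powr_mono2) (auto simp: dirichlet_norm_def)
    finally have "dirichlet_mass \<alpha> p f \<le> ennreal ((max M 0) powr p)"
      using fs by (metis dirichlet_space_iff ennreal_enn2real ennreal_leI infinity_ennreal_def)
    then have "ennreal (1 / pi) * bergman_mass \<alpha> p (deriv f) \<le> ennreal ((max M 0) powr p)"
      by (simp add: dirichlet_mass_def) (meson dual_order.trans le_add2 le_add_same_cancel2 zero_le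
          add_increasing order_refl)
    then have "ennreal pi * (ennreal (1 / pi) * bergman_mass \<alpha> p (deriv f)) \<le>
        ennreal pi * ennreal ((max M 0) powr p)"
      by (intro mult_left_mono) auto
    then show "bergman_mass \<alpha> p (deriv f) \<le> ennreal (pi * (max M 0) powr p)"
      by (simp add: ennreal_mult' flip: mult.assoc) (simp flip: ennreal_mult')
  qed simp
qed

lemma dirichlet_boundedI:
  assumes p: "0 < p" and B: "B \<subseteq> holo_disk" and K: "K < \<infinity>" "\<And>f. f \<in> B \<Longrightarrow> dirichlet_mass \<alpha> p f \<le> K"
  shows "dirichlet_bounded \<alpha> p B"
  unfolding dirichlet_bounded_def
proof (intro conjI exI[of _ "enn2real K powr (1 / p)"] ballI)
  show sub: "B \<subseteq> dirichlet_space \<alpha> p"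
    using B K(2) order_le_less_trans[OF K(2) K(1)] by (auto simp: dirichlet_space_iff)
  fix f assume f: "f \<in> B"
  have "dirichlet_norm \<alpha> p f = enn2real (dirichlet_mass \<alpha> p f) powr (1 / p)"
    using sub f dirichlet_norm_eq by blast
  also have "\<dots> \<le> enn2real K powr (1 / p)"
    using p K f by (intro powr_mono2 enn2real_mono) auto
  finally show "dirichlet_norm \<alpha> p f \<le> enn2real K powr (1 / p)" .
qed

lemma dirichlet_mass_S_op:
  assumes "0 < p" "f holomorphic_on unit_disk" "g holomorphic_on unit_disk"
  shows "dirichlet_mass \<beta> p (S_op g f) = ennreal (1 / pi) * bergman_mass \<beta> p (\<lambda>z. deriv f z * g z)"
proof -
  have "bergman_mass \<beta> p (deriv (S_op g f)) = bergman_mass \<beta> p (\<lambda>z. deriv f z * g z)"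
    using deriv_S_op[OF assms(2,3)] by (rule bergman_mass_cong)
  then show ?thesis using assms(1) S_op_0[OF assms(2,3)] by (simp add: dirichlet_mass_def)
qed

lemma S_op_compact_if_smallo:
  fixes \<alpha> \<beta> p q :: real and g :: "complex \<Rightarrow> complex"
  assumes \<beta>: "\<beta> > -1" and g: "g holomorphic_on unit_disk" and pq: "0 < p" "p < q"
    and small: "\<And>c. 0 < c \<Longrightarrow> \<exists>r<1. \<forall>z. r < norm z \<and> norm z < 1 \<longrightarrow>
      norm (g z) \<le> c * (1 - (norm z)\<^sup>2) powr ((2 + \<alpha>) / p - (2 + \<beta>) / q)"
  shows "dirichlet_compact_operator \<alpha> p \<beta> q (S_op g)"
proof -
  let ?\<gamma> = "(2 + \<alpha>) / p - (2 + \<beta>) / q"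
  have q: "0 < q" using pq by simp
  obtain C where C: "C > 0" "\<And>F a. F holomorphic_on unit_disk \<Longrightarrow> a \<in> unit_disk \<Longrightarrow>
       ennreal (norm (F a) powr p * (1 - (norm a)\<^sup>2) powr (\<alpha> + 2)) \<le> ennreal C * bergman_mass \<alpha> p F"
    using bergman_point_estimate[OF pq(1)] by blast
  obtain c where c: "0 \<le> c" "\<And>z. z \<in> unit_disk \<Longrightarrow> norm (g z) \<le> c * (1 - (norm z)\<^sup>2) powr ?\<gamma>"
    using smallo_imp_weight_bound[OF g small] by blast
  \<comment> \<open>\<open>b\<close> bounds \<open>g\<close> at the single point \<open>z\<close>
    only, so the estimate serves with the global \<open>c\<close> and, near the circle, with an
    arbitrarily small constant.\<close>
  have prod: "norm (H z * g z) powr q * (1 - (norm z)\<^sup>2) powr \<beta>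
      \<le> (C * L) powr ((q - p) / p) * b powr q * (norm (H z) powr p * (1 - (norm z)\<^sup>2) powr \<alpha>)"
    if H: "H holomorphic_on unit_disk" "bergman_mass \<alpha> p H \<le> ennreal L" "0 \<le> L"
      and z: "z \<in> unit_disk" and b: "0 \<le> b" "norm (g z) \<le> b * (1 - (norm z)\<^sup>2) powr ?\<gamma>"
    for H L z b
  proof (rule weighted_product_le[OF pq _ b(1) _ _ b(2)])
    show "0 < 1 - (norm z)\<^sup>2" using z weight_pos by simp
    show "0 \<le> C * L" using C(1) H(3) by simp
    have "ennreal (norm (H z) powr p * (1 - (norm z)\<^sup>2) powr (\<alpha> + 2)) \<le> ennreal C * ennreal L"
      using C(2)[OF H(1) z] H(2) by (meson mult_left_mono order_trans zero_le)
    then show "norm (H z) powr p * (1 - (norm z)\<^sup>2) powr (\<alpha> + 2) \<le> C * L"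
      using C(1) H(3) by (simp flip: ennreal_mult')
  qed
  have prod_fin: "bergman_mass \<beta> q (\<lambda>z. H z * g z) < \<infinity>"
    if H: "H holomorphic_on unit_disk" "bergman_mass \<alpha> p H < \<infinity>" for H
  proof -
    define L where "L = enn2real (bergman_mass \<alpha> p H)"
    have L: "bergman_mass \<alpha> p H \<le> ennreal L" "0 \<le> L" using H(2) by (auto simp: L_def)
    have "bergman_mass \<beta> q (\<lambda>z. H z * g z) \<le> ennreal ((C * L) powr ((q - p) / p) * c powr q) *
        bergman_mass \<alpha> p H"
      using H(1) L c by (intro bergman_mass_mono_cmult prod holomorphic_on_imp_continuous_on) auto
    also have "\<dots> < \<infinity>" using H(2) by (simp add: ennreal_mult_less_top)
    finally show ?thesis .
  qed
  have mass_fin: "bergman_mass \<alpha> p (deriv f) < \<infinity>" if "f \<in> dirichlet_space \<alpha> p" for f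
    using that by (auto simp: dirichlet_space_iff dirichlet_mass_def ennreal_mult_less_top)
  have maps: "S_op g f \<in> dirichlet_space \<beta> q" if f: "f \<in> dirichlet_space \<alpha> p" for f
  proof -
    have hol: "f holomorphic_on unit_disk" using f by (auto simp: dirichlet_space_iff holo_diskD)
    have "bergman_mass \<beta> q (\<lambda>z. deriv f z * g z) < \<infinity>"
      using prod_fin[OF holomorphic_deriv[OF hol open_ball] mass_fin[OF f]] .
    then show ?thesis
      using S_op_in_holo_disk[OF hol g] dirichlet_mass_S_op[OF q hol g, of \<beta>]
      by (simp add: dirichlet_space_iff ennreal_mult_less_top)
  qed
  have "relatively_compact_in (dirichlet_topology \<beta> q) (S_op g ` B)" if B: "dirichlet_bounded \<alpha> p B"
      for B
  proof -
    have Bs: "B \<subseteq> dirichlet_space \<alpha> p" using B by (simp add: dirichlet_bounded_def)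
    then have sub: "S_op g ` B \<subseteq> dirichlet_space \<beta> q" using maps by auto
    obtain L where L: "0 \<le> L" "\<And>f. f \<in> B \<Longrightarrow> bergman_mass \<alpha> p (deriv f) \<le> ennreal L"
      using dirichlet_bounded_imp_mass_bound[OF pq(1) B] by blast
    show ?thesis
      unfolding relatively_compact_in_dirichlet_iff[OF q sub]
    proof (intro allI impI)
      fix \<sigma> :: "nat \<Rightarrow> complex \<Rightarrow> complex" assume "range \<sigma> \<subseteq> S_op g ` B"
      then have "\<forall>n. \<exists>f. f \<in> B \<and> \<sigma> n = S_op g f" by blast
      then obtain f where f: "\<And>n. f n \<in> B" "\<And>n. \<sigma> n = S_op g (f n)" by metis
      have fhol: "f n holomorphic_on unit_disk" for n
        using f(1)[of n] Bs by (auto simp: dirichlet_space_iff intro!: holo_diskD)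
      define F where "F n = deriv (f n)" for n
      have Fhol: "F n holomorphic_on unit_disk" for n
        unfolding F_def using fhol by (intro holomorphic_deriv) auto
      have FL: "bergman_mass \<alpha> p (F n) \<le> ennreal L" for n
        unfolding F_def using L(2) f(1) by blast
      \<comment> \<open>A ball for the mass: the point estimate bounds it uniformly on compact
        subsets, which is what Montel's theorem requires.\<close>
      define \<H> where "\<H> = {h. h holomorphic_on unit_disk \<and> bergman_mass \<alpha> p h \<le> ennreal L}"
      have loc_bounded: "\<exists>b. \<forall>h\<in>\<H>. \<forall>z\<in>K. norm (h z) \<le> b" if K: "compact K" "K \<subseteq> unit_disk" for K
      proof -
        have w: "0 < 1 - (norm z)\<^sup>2" if "z \<in> K" for z using K(2) that by (intro weight_pos) auto
        have "bounded ((\<lambda>z. (C * L * (1 - (norm z)\<^sup>2) powr (- (\<alpha> + 2))) powr (1 / p)) ` K)"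
          using K(1) w C(1) L(1) pq
          by (intro compact_imp_bounded compact_continuous_image continuous_on_powr'
              continuous_intros) force+
        then obtain b where b: "\<And>z. z \<in> K \<Longrightarrow> (C * L * (1 - (norm z)\<^sup>2) powr (- (\<alpha> + 2))) powr (1 / p) \<le>
            b"
          by (fastforce simp: bounded_real)
        have "norm (h z) \<le> b" if h: "h \<in> \<H>" and z: "z \<in> K" for h z
        proof -
          have "ennreal (norm (h z) powr p * (1 - (norm z)\<^sup>2) powr (\<alpha> + 2)) \<le>
              ennreal C * bergman_mass \<alpha> p h"
            using C(2)[of h z] h subsetD[OF K(2) z] by (auto simp: \<H>_def)
          also have "\<dots> \<le> ennreal C * ennreal L"
            using h by (intro mult_left_mono) (auto simp: \<H>_def)
          finally have "ennreal (norm (h z) powr p * (1 - (norm z)\<^sup>2) powr (\<alpha> + 2)) \<le>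
              ennreal C * ennreal L" .
          then have "norm (h z) powr p * (1 - (norm z)\<^sup>2) powr (\<alpha> + 2) \<le> C * L"
            using C(1) L(1) by (simp flip: ennreal_mult')
          then have "norm (h z) powr p \<le> C * L * (1 - (norm z)\<^sup>2) powr (- (\<alpha> + 2))"
            using w[OF z] unfolding powr_minus by (simp add: field_simps)
          then have "(norm (h z) powr p) powr (1 / p) \<le>
              (C * L * (1 - (norm z)\<^sup>2) powr (- (\<alpha> + 2))) powr (1 / p)"
            using pq by (intro powr_mono2) auto
          then show ?thesis using b[OF z] pq by (simp add: powr_powr)
        qed
        then show ?thesis by blast
      qed
      have "F n \<in> \<H>" for n using Fhol FL by (simp add: \<H>_def)
      then have rng: "range F \<subseteq> \<H>" by blast
      obtain G r where G: "G holomorphic_on unit_disk" and r: "strict_mono r"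
        and ptw: "\<And>z. z \<in> unit_disk \<Longrightarrow> (\<lambda>n. F (r n) z) \<longlonglongrightarrow> G z"
        and unif: "\<And>K. compact K \<Longrightarrow> K \<subseteq> unit_disk \<Longrightarrow> uniform_limit K (F \<circ> r) G sequentially"
        by (rule Montel[OF open_ball _ loc_bounded rng]) (auto simp: \<H>_def)
      have GL: "bergman_mass \<alpha> p G \<le> ennreal L"
        by (rule bergman_mass_liminf_le[where F =
            "\<lambda>n. F (r n)", OF holomorphic_on_imp_continuous_on[OF Fhol] ptw FL pq(1)])
      obtain A where A: "0 \<le> A" "\<And>x y :: complex. norm (x + y) powr p \<le>
          A * norm x powr p + A * norm y powr p"
        using powr_add_le_quasi[OF pq(1)] by blast
      define H where "H n z = F (r n) z - G z" for n z
      have Hhol: "H n holomorphic_on unit_disk" for n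
        unfolding H_def using Fhol G by (intro holomorphic_intros)
      define L' where "L' = A * L + A * L"
      have L': "0 \<le> L'" using A L by (simp add: L'_def)
      have HL: "bergman_mass \<alpha> p (H n) \<le> ennreal L'" for n
      proof -
        have "bergman_mass \<alpha> p (\<lambda>z. F (r n) z + - G z) \<le>
            ennreal A * bergman_mass \<alpha> p (F (r n)) + ennreal A * bergman_mass \<alpha> p (\<lambda>z. - G z)"
          using Fhol G A by (intro bergman_mass_add_le continuous_intros
              holomorphic_on_imp_continuous_on)
        also have "\<dots> \<le> ennreal A * ennreal L + ennreal A * ennreal L"
          unfolding bergman_mass_minus using FL GL by (intro add_mono mult_left_mono) auto
        also have "\<dots> = ennreal L'" unfolding L'_def using A(1) L(1)
            by (subst ennreal_plus) (auto simp: ennreal_mult)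
        finally show ?thesis by (simp add: H_def[abs_def])
      qed
      \<comment> \<open>The images vanish at 0 and their derivatives converge pointwise to
        \<open>G * g\<close>, so the only candidate for their limit is this primitive.\<close>
      obtain l where l: "l \<in> holo_disk" "l 0 = 0" "\<And>z. z \<in> unit_disk \<Longrightarrow> deriv l z = G z * g z"
        using holo_disk_primitive[OF holomorphic_on_mult[OF G g]] by blast
      have "bergman_mass \<beta> q (deriv l) = bergman_mass \<beta> q (\<lambda>z. G z * g z)"
        using l(3) by (rule bergman_mass_cong)
      also have "\<dots> < \<infinity>" using GL by (intro prod_fin G) (auto simp: less_top[symmetric] top_unique)
      finally have ls: "l \<in> dirichlet_space \<beta> q"
        using l q by (simp add: dirichlet_space_iff dirichlet_mass_def ennreal_mult_less_top)
      define K where "K = (C * L') powr ((q - p) / p)"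
      define W where "W = enn2real (bergman_mass \<beta> q (\<lambda>_. 1))"
      have W: "bergman_mass \<beta> q (\<lambda>_. 1) = ennreal W" "0 \<le> W"
        using bergman_mass_one_finite[OF \<beta>, of q] by (auto simp: W_def)
      have ev: "\<forall>\<^sub>F n in sequentially. bergman_mass \<beta> q (\<lambda>z. H n z * g z) \<le>
          ennreal (2 * e)" if e: "e > 0" for e
      proof -
        \<comment> \<open>Solves K c1^q L' <= e, the share of the annulus; the added 1 keeps the
          quotient meaningful when K L' = 0.\<close>
        define c1 where "c1 = (e / (K * L' + 1)) powr (1 / q)"
        have K0: "0 \<le> K" by (simp add: K_def)
        have KL: "0 < K * L' + 1" using K0 L' by (simp add: add_nonneg_pos)
        have c1: "c1 > 0" "K * c1 powr q * L' \<le> e"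
          using e KL q K0 L' by (auto simp: c1_def powr_powr field_simps)
        obtain s where s: "s < 1" "\<And>z. s < norm z \<Longrightarrow> norm z < 1 \<Longrightarrow>
            norm (g z) \<le> c1 * (1 - (norm z)\<^sup>2) powr ?\<gamma>"
          using small[OF c1(1)] by blast
        have sub: "cball 0 s \<subseteq> unit_disk" using s(1) by auto
        have "bounded (g ` cball 0 s)"
          using sub g by (intro compact_imp_bounded compact_continuous_image)
            (auto intro: holomorphic_on_imp_continuous_on continuous_on_subset)
        then obtain b where b: "b > 0" "\<And>z. z \<in> cball 0 s \<Longrightarrow> norm (g z) \<le> b"
          by (auto simp: bounded_pos)
        \<comment> \<open>The counterpart on the closed disk, solving (\<eta> b)^q W <= e.\<close>
        define \<eta> where "\<eta> = (e / (W + 1)) powr (1 / q) / b"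
        have W1: "0 < W + 1" using W(2) by simp
        have \<eta>: "\<eta> > 0" "(\<eta> * b) powr q * W \<le> e"
          using e W1 W(2) b(1) q by (auto simp: \<eta>_def powr_powr field_simps)
        have "uniform_limit (cball 0 s) (F \<circ> r) G sequentially"
          using sub by (intro unif) auto
        then have "\<forall>\<^sub>F n in sequentially. \<forall>z\<in>cball 0 s. dist ((F \<circ> r) n z) (G z) < \<eta>"
          using \<eta>(1) by (auto simp: uniform_limit_iff)
        then show ?thesis
        proof (rule eventually_mono)
          fix n assume n: "\<forall>z\<in>cball 0 s. dist ((F \<circ> r) n z) (G z) < \<eta>"
          let ?w = "\<lambda>F p \<alpha> z. ennreal (norm (F z :: complex) powr p * (1 - (norm z)\<^sup>2) powr \<alpha>) *
              indicator unit_disk z"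
          have one: "continuous_on unit_disk (\<lambda>_. 1 :: complex)" by simp
          have cH: "continuous_on unit_disk (H n)" using Hhol holomorphic_on_imp_continuous_on
              by blast
          \<comment> \<open>Both bounds are nonnegative, so their sum dominates the integrand on the
            whole disk and the integral need not be split into two regions.\<close>
          have "bergman_mass \<beta> q (\<lambda>z. H n z * g z) \<le>
              (\<integral>\<^sup>+z. ennreal (K * c1 powr q) * ?w (H n) p \<alpha> z
                  + ennreal ((\<eta> * b) powr q) * ?w (\<lambda>_. 1) q \<beta> z \<partial>lborel)"
            unfolding bergman_mass_def
          proof (rule nn_integral_mono)
            fix z
            show "?w (\<lambda>z. H n z * g z) q \<beta> z \<le> ennreal (K * c1 powr q) * ?w (H n) p \<alpha> z
                + ennreal ((\<eta> * b) powr q) * ?w (\<lambda>_. 1) q \<beta> z"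
            proof (cases "z \<in> unit_disk")
              case z: True
              show ?thesis
              proof (cases "norm z \<le> s")
                case True
                then have "norm (H n z) \<le> \<eta>" "norm (g z) \<le> b"
                  using n b(2) by (auto simp: H_def dist_norm less_imp_le)
                then have "norm (H n z * g z) \<le> \<eta> * b"
                  unfolding norm_mult using \<eta>(1) by (intro mult_mono) auto
                then have "norm (H n z * g z) powr q * (1 - (norm z)\<^sup>2) powr \<beta> \<le>
                    (\<eta> * b) powr q * (1 - (norm z)\<^sup>2) powr \<beta>"
                  using q by (intro mult_right_mono powr_mono2) auto
                then have "?w (\<lambda>z. H n z * g z) q \<beta> z \<le> ennreal ((\<eta> * b) powr q) * ?w (\<lambda>_. 1) q \<beta> z"
                  using z by (simp add: ennreal_leI flip: ennreal_mult')
                then show ?thesis by (rule order_trans) simp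
              next
                case False
                then have "norm (g z) \<le> c1 * (1 - (norm z)\<^sup>2) powr ?\<gamma>" using s(2) z by simp
                from prod[OF Hhol[of n] HL L' z _ this]
                have "norm (H n z * g z) powr q * (1 - (norm z)\<^sup>2) powr \<beta> \<le>
                    K * c1 powr q * (norm (H n z) powr p * (1 - (norm z)\<^sup>2) powr \<alpha>)"
                  using c1(1) unfolding K_def by simp
                then have "?w (\<lambda>z. H n z * g z) q \<beta> z \<le> ennreal (K * c1 powr q) * ?w (H n) p \<alpha> z"
                  using z K0 by (simp add: ennreal_leI flip: ennreal_mult')
                then show ?thesis by (rule order_trans) simp
              qed
            qed simp
          qed
          also have "\<dots> = ennreal (K * c1 powr q) * bergman_mass \<alpha> p (H n)
              + ennreal ((\<eta> * b) powr q) * bergman_mass \<beta> q (\<lambda>_. 1)"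
            unfolding bergman_mass_def nn_integral_cmult[OF bergman_mass_measurable[OF cH],
                symmetric]
              nn_integral_cmult[OF bergman_mass_measurable[OF one], symmetric]
            by (intro nn_integral_add borel_measurable_times_ennreal borel_measurable_const
                bergman_mass_measurable cH one)
          also have "\<dots> \<le> ennreal (K * c1 powr q) * ennreal L'
              + ennreal ((\<eta> * b) powr q) * ennreal W"
            unfolding W(1) using HL by (intro add_mono mult_left_mono) auto
          also have "\<dots> = ennreal (K * c1 powr q * L' + (\<eta> * b) powr q * W)"
            using K0 L' W(2) by (subst ennreal_plus) (auto simp: ennreal_mult)
          also have "\<dots> \<le> ennreal (2 * e)"
            using c1(2) \<eta>(2) by (intro ennreal_leI) linarith
          finally show "bergman_mass \<beta> q (\<lambda>z. H n z * g z) \<le> ennreal (2 * e)" .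
        qed
      qed
      have mass: "dirichlet_mass \<beta> q (\<lambda>z. \<sigma> (r n) z - l z) =
          ennreal (1 / pi) * bergman_mass \<beta> q (\<lambda>z. H n z * g z)" for n
      proof -
        have "deriv (\<lambda>z. \<sigma> (r n) z - l z) z = H n z * g z" if z: "z \<in> unit_disk" for z
          using deriv_diff_holo_disk[OF S_op_in_holo_disk[OF fhol g] l(1) z] deriv_S_op[OF fhol g z]
              l(3)[OF z]
          by (simp add: f(2) H_def F_def algebra_simps)
        then have "bergman_mass \<beta> q (deriv (\<lambda>z. \<sigma> (r n) z - l z)) =
            bergman_mass \<beta> q (\<lambda>z. H n z * g z)"
          by (rule bergman_mass_cong)
        then show ?thesis
          using q l(2) S_op_0[OF fhol g] by (simp add: dirichlet_mass_def f(2))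
      qed
      have "(\<lambda>n. bergman_mass \<beta> q (\<lambda>z. H n z * g z)) \<longlonglongrightarrow> 0"
      proof (rule order_tendstoI)
        fix a :: ennreal assume "0 < a"
        then obtain e where e: "0 < e" "ennreal (2 * e) < a"
        proof -
          obtain x where x: "0 < x" "x < a" using \<open>0 < a\<close> dense by blast
          then have "x < top" by (auto intro: less_trans simp: less_top[symmetric])
          then obtain y where y: "x = ennreal y" "0 \<le> y" by (cases x) auto
          show ?thesis using that[of "y / 2"] x y by auto
        qed
        show "\<forall>\<^sub>F n in sequentially. bergman_mass \<beta> q (\<lambda>z. H n z * g z) < a"
          using ev[OF e(1)] by (rule eventually_mono) (use e(2) in auto)
      qed simp
      then have "(\<lambda>n. ennreal (1 / pi) * bergman_mass \<beta> q (\<lambda>z. H n z * g z)) \<longlonglongrightarrow> ennreal (1 / pi) * 0"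
        by (intro ennreal_tendsto_cmult) auto
      then have "(\<lambda>n. dirichlet_mass \<beta> q (\<lambda>z. \<sigma> (r n) z - l z)) \<longlonglongrightarrow> 0"
        by (simp add: mass)
      then show "\<exists>l\<in>dirichlet_space \<beta> q. \<exists>r. strict_mono r \<and> (\<lambda>n. dirichlet_mass \<beta> q (\<lambda>z. \<sigma> (r n) z
          - l z)) \<longlonglongrightarrow> 0"
        using ls r by blast
    qed
  qed
  then show ?thesis
    using maps by (auto simp: dirichlet_compact_operator_def)
qed

section \<open>Necessity\<close>

lemma norm_test_function_centre:
  assumes "norm a < 1" "0 < p"
  shows "norm (test_function \<alpha> p N a a) = (1 - (norm a)\<^sup>2) powr (- ((2 + \<alpha>) / p))"
proof -
  define d where "d = 1 - (norm a)\<^sup>2"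
  have d: "d > 0" using assms(1) weight_pos by (simp add: d_def)
  have dc: "1 - cnj a * a = complex_of_real d"
    unfolding d_def of_real_diff complex_norm_square by (simp add: mult.commute)
  have "norm (test_function \<alpha> p N a a) = d powr (real N - (2 + \<alpha>) / p) / d powr real N"
    using d by (simp add: test_function_def dc norm_divide norm_power powr_realpow flip: d_def)
  also have "\<dots> = d powr (real N - (2 + \<alpha>) / p - real N)" by (rule powr_diff[symmetric])
  finally show ?thesis by (simp add: d_def)
qed

text \<open>For fixed z the denominator is bounded below independently of \<open>a\<close>, so for
  large \<open>N\<close> the numerator drives the values to 0 as |a| tends to 1.\<close>

lemma norm_test_function_le:
  assumes a: "norm a < 1" and z: "norm z < 1"
  shows "norm (test_function \<alpha> p N a z) \<le> (1 - (norm a)\<^sup>2) powr (real N - (2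
      + \<alpha>) / p) / (1 - norm z) ^ N"
proof -
  have "norm (cnj a * z) \<le> 1 * norm z" unfolding norm_mult using a by (intro mult_right_mono) auto
  then have le: "1 - norm z \<le> norm (1 - cnj a * z)"
    using norm_triangle_ineq2[of 1 "cnj a * z"] by simp
  then show ?thesis
    unfolding test_function_def norm_divide norm_power
    using z by (intro frac_le power_mono zero_less_power) auto
qed

lemma smallo_if_S_op_compact:
  fixes \<alpha> \<beta> p q :: real and g :: "complex \<Rightarrow> complex"
  assumes \<alpha>: "\<alpha> > -1" and g: "g holomorphic_on unit_disk" and pq: "0 < p" "p < q"
    and comp: "dirichlet_compact_operator \<alpha> p \<beta> q (S_op g)" and c: "0 < c"
  shows "\<exists>r<1. \<forall>z. r < norm z \<and> norm z < 1 \<longrightarrow>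
      norm (g z) \<le> c * (1 - (norm z)\<^sup>2) powr ((2 + \<alpha>) / p - (2 + \<beta>) / q)"
proof (rule ccontr)
  let ?\<gamma> = "(2 + \<alpha>) / p - (2 + \<beta>) / q"
  assume contra: "\<not> ?thesis"
  have q: "0 < q" using pq by simp
  \<comment> \<open>The negated claim at the radii 1 - 1/(n+1) yields points tending to the circle
    at which \<open>g\<close> violates the bound with the same \<open>c\<close>.\<close>
  have "\<exists>z. 1 - 1 / real (Suc n) < norm z \<and> norm z < 1 \<and> c * (1 - (norm z)\<^sup>2) powr ?\<gamma> <
      norm (g z)" for n
  proof -
    have "1 - 1 / real (Suc n) < 1" by simp
    then show ?thesis using contra by (meson not_le)
  qed
  then obtain a where a: "\<And>n. 1 - 1 / real (Suc n) < norm (a n)" "\<And>n. norm (a n) < 1"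
      "\<And>n. c * (1 - (norm (a n))\<^sup>2) powr ?\<gamma> < norm (g (a n))"
    by metis
  define d where "d n = 1 - (norm (a n))\<^sup>2" for n
  have d: "d n > 0" for n unfolding d_def using a(2) by (rule weight_pos)
  have "(\<lambda>n. norm (a n)) \<longlonglongrightarrow> 1"
  proof (rule tendsto_sandwich)
    show "\<forall>\<^sub>F n in sequentially. 1 - inverse (real (Suc n)) \<le> norm (a n)"
      unfolding inverse_eq_divide using a(1) by (intro always_eventually allI less_imp_le)
    show "\<forall>\<^sub>F n in sequentially. norm (a n) \<le> 1"
      using a(2) by (intro always_eventually allI less_imp_le)
    show "(\<lambda>n. 1 - inverse (real (Suc n))) \<longlonglongrightarrow> 1"
      using tendsto_diff[OF tendsto_const LIMSEQ_inverse_real_of_nat, of 1] by simp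
  qed simp
  then have "(\<lambda>n. 1 - (norm (a n))\<^sup>2) \<longlonglongrightarrow> 1 - 1\<^sup>2" by (intro tendsto_intros)
  then have d0: "d \<longlonglongrightarrow> 0" by (simp add: d_def[abs_def])
  \<comment> \<open>4 + 2 \<alpha> is twice the positive number 2 + \<alpha>, so this one choice
    also gives the strict inequality \<open>N2\<close>.\<close>
  obtain N :: nat where N: "(4 + 2 * \<alpha>) / p \<le> real N" using real_arch_simple by blast
  have N1: "4 + 2 * \<alpha> \<le> real N * p" using N pq by (simp add: pos_divide_le_eq)
  have N2: "real N - (2 + \<alpha>) / p > 0"
  proof -
    have "(2 + \<alpha>) / p < (4 + 2 * \<alpha>) / p" using \<alpha> pq by (intro divide_strict_right_mono) auto
    then show ?thesis using N by linarith
  qed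
  define t where "t n = test_function \<alpha> p N (a n)" for n
  have thol: "t n holomorphic_on unit_disk" for n
    unfolding t_def using a(2) by (rule holomorphic_test_function)
  have "\<exists>f. f \<in> holo_disk \<and> f 0 = 0 \<and> (\<forall>z\<in>unit_disk. deriv f z = t n z)" for n
    using holo_disk_primitive[OF thol] by metis
  then obtain f where f: "\<And>n. f n \<in> holo_disk" "\<And>n. f n 0 = 0" "\<And>n z. z \<in> unit_disk \<Longrightarrow>
      deriv (f n) z = t n z"
    by metis
  define K where "K = ennreal (2 powr (real N * p - 4 - 2 * \<alpha>)) * bergman_mass \<alpha> p (\<lambda>_. 1)"
  have "dirichlet_bounded \<alpha> p (range f)"
  proof (rule dirichlet_boundedI[OF pq(1)])
    show "ennreal (1 / pi) * K < \<infinity>"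
      using bergman_mass_one_finite[OF \<alpha>, of p] by (simp add: K_def ennreal_mult_less_top)
    fix h assume "h \<in> range f"
    then obtain n where h: "h = f n" by blast
    have "bergman_mass \<alpha> p (deriv (f n)) = bergman_mass \<alpha> p (t n)"
      using f(3) by (rule bergman_mass_cong)
    also have "\<dots> \<le> K"
      unfolding t_def K_def using pq(1) N1 a(2) by (rule bergman_mass_test_function)
    finally show "dirichlet_mass \<alpha> p h \<le> ennreal (1 / pi) * K"
      using pq(1) f(2) by (simp add: h dirichlet_mass_def mult_left_mono)
  qed (use f(1) in auto)
  then have rel: "relatively_compact_in (dirichlet_topology \<beta> q) (S_op g ` range f)"
    using comp by (simp add: dirichlet_compact_operator_def)
  then have sub: "S_op g ` range f \<subseteq> dirichlet_space \<beta> q"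
    by (simp add: relatively_compact_in_def)
  have "range (\<lambda>n. S_op g (f n)) \<subseteq> S_op g ` range f" by auto
  then obtain l r where l: "l \<in> dirichlet_space \<beta> q" and r: "strict_mono r"
    and lim: "(\<lambda>n. dirichlet_mass \<beta> q (\<lambda>z. S_op g (f (r n)) z - l z)) \<longlonglongrightarrow> 0"
    using rel unfolding relatively_compact_in_dirichlet_iff[OF q sub] by blast
  have lh: "l \<in> holo_disk" using l by (simp add: dirichlet_space_iff)
  define u where "u n z = t (r n) z * g z" for n z
  have uhol: "u n holomorphic_on unit_disk" for n
    unfolding u_def using thol g by (intro holomorphic_intros)
  have dl: "deriv l holomorphic_on unit_disk"
    using holo_diskD[OF lh] by (intro holomorphic_deriv) auto
  have lim_u: "(\<lambda>n. bergman_mass \<beta> q (\<lambda>z. u n z - deriv l z)) \<longlonglongrightarrow> 0"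
  proof -
    have le: "bergman_mass \<beta> q (\<lambda>z. u n z - deriv l z) \<le>
        ennreal pi * dirichlet_mass \<beta> q (\<lambda>z. S_op g (f (r n)) z - l z)" for n
    proof -
      have hol: "f (r n) holomorphic_on unit_disk" using f(1) by (rule holo_diskD)
      have "bergman_mass \<beta> q (\<lambda>z. u n z - deriv l z) =
          bergman_mass \<beta> q (deriv (\<lambda>z. S_op g (f (r n)) z - l z))"
      proof (rule bergman_mass_cong)
        fix z assume z: "z \<in> unit_disk"
        show "u n z - deriv l z = deriv (\<lambda>z. S_op g (f (r n)) z - l z) z"
          using deriv_diff_holo_disk[OF S_op_in_holo_disk[OF hol g] lh z] deriv_S_op[OF hol g z]
              f(3)[OF z]
          by (simp add: u_def)
      qed
      also have "\<dots> = ennreal pi * (ennreal (1 / pi) * bergman_mass \<beta> q (deriv (\<lambda>z. S_op g (f (r n))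
          z - l z)))"
        by (simp flip: ennreal_mult' mult.assoc)
      also have "\<dots> \<le> ennreal pi * dirichlet_mass \<beta> q (\<lambda>z. S_op g (f (r n)) z - l z)"
        unfolding dirichlet_mass_def by (intro mult_left_mono) auto
      finally show ?thesis .
    qed
    have up: "(\<lambda>n. ennreal pi * dirichlet_mass \<beta> q (\<lambda>z. S_op g (f (r n)) z - l z)) \<longlonglongrightarrow> 0"
      using ennreal_tendsto_cmult[OF _ lim, of "ennreal pi"] by simp
    show ?thesis
      by (rule tendsto_sandwich[OF _ always_eventually[OF allI[OF le]] tendsto_const up]) simp
  qed
  obtain C where C: "C > 0" "\<And>F a. F holomorphic_on unit_disk \<Longrightarrow> a \<in> unit_disk \<Longrightarrow>
       ennreal (norm (F a) powr q * (1 - (norm a)\<^sup>2) powr (\<beta> + 2)) \<le> ennreal C * bergman_mass \<beta> q F"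
    using bergman_point_estimate[OF q] by blast
  have limC: "(\<lambda>n. ennreal C * bergman_mass \<beta> q (\<lambda>z. u n z - deriv l z)) \<longlonglongrightarrow> 0"
    using ennreal_tendsto_cmult[OF _ lim_u, of "ennreal C"] by simp
  \<comment> \<open>At a fixed \<open>z\<close> the point estimate turns \<open>limC\<close> into
    convergence of \<open>u n z\<close> to \<open>deriv l z\<close>, while \<open>u n z\<close>
    tends to 0 because \<open>d (r n)\<close> enters it with the positive exponent of
    \<open>N2\<close>.\<close>
  have dl0: "deriv l z = 0" if z: "z \<in> unit_disk" for z
  proof -
    have z1: "norm z < 1" using z by simp
    define w where "w = (1 - (norm z)\<^sup>2) powr (\<beta> + 2)"
    have w: "w > 0" using weight_pos[OF z1] by (simp add: w_def)
    have "(\<lambda>n. ennreal (norm (u n z - deriv l z) powr q * w)) \<longlonglongrightarrow> 0"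
    proof (rule tendsto_sandwich[OF _ _ tendsto_const limC])
      show "\<forall>\<^sub>F n in sequentially. ennreal (norm (u n z - deriv l z) powr q * w) \<le>
          ennreal C * bergman_mass \<beta> q (\<lambda>z. u n z - deriv l z)"
        unfolding w_def using C(2)[OF holomorphic_on_diff[OF uhol dl] z] by simp
    qed simp
    then have 1: "(\<lambda>n. norm (u n z - deriv l z) powr q * w) \<longlonglongrightarrow> 0"
      using w by (subst (asm) ennreal_0[symmetric], subst (asm) tendsto_ennreal_iff) auto
    have u0: "(\<lambda>n. u n z) \<longlonglongrightarrow> 0"
    proof (rule tendsto_norm_zero_cancel, rule tendsto_sandwich[OF _ _ tendsto_const])
      show "\<forall>\<^sub>F n in sequentially. norm (u n z) \<le>
          d (r n) powr (real N - (2 + \<alpha>) / p) / (1 - norm z) ^ N * norm (g z)"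
        unfolding u_def norm_mult t_def d_def using a(2) z1
        by (intro always_eventually allI mult_right_mono norm_test_function_le) auto
      have "(\<lambda>n. d (r n)) \<longlonglongrightarrow> 0" using LIMSEQ_subseq_LIMSEQ[OF d0 r] by (simp add: o_def)
      then have "(\<lambda>n. d (r n) powr (real N - (2 + \<alpha>) / p)) \<longlonglongrightarrow> 0"
        using N2 less_imp_le[OF d]
        by (rule_tac tendsto_zero_powrI[OF _ tendsto_const always_eventually]) auto
      then have "(\<lambda>n. d (r n) powr (real N - (2 + \<alpha>) / p) / (1 - norm z) ^ N * norm (g z)) \<longlonglongrightarrow>
          0 / (1 - norm z) ^ N * norm (g z)"
        using z1 by (intro tendsto_intros) auto
      then show "(\<lambda>n. d (r n) powr (real N - (2 + \<alpha>) / p) / (1 - norm z) ^ N * norm (g z)) \<longlonglongrightarrow>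
          0" by simp
    qed simp
    have "(\<lambda>n. norm (u n z - deriv l z) powr q * w) \<longlonglongrightarrow> norm (0 - deriv l z) powr q * w"
      using q u0 by (intro tendsto_mult tendsto_powr' tendsto_norm tendsto_diff tendsto_const) auto
    from LIMSEQ_unique[OF this 1] show ?thesis using w by simp
  qed
  have "bergman_mass \<beta> q (\<lambda>z. u n z - deriv l z) = bergman_mass \<beta> q (u n)" for n
    using dl0 by (intro bergman_mass_cong) simp
  then have limC': "(\<lambda>n. ennreal C * bergman_mass \<beta> q (u n)) \<longlonglongrightarrow> 0"
    using limC by simp
  \<comment> \<open>At \<open>a (r n)\<close> the test function has modulus d^(-(2 + \<alpha>)/p)
    and \<open>g\<close> exceeds c d^\<gamma>, so |u n| is at least c d^(-(2 + \<beta>)/q). Its q-th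
    power cancels the weight d^(\<beta> + 2) of the point estimate.\<close>
  have low: "ennreal (c powr q) \<le> ennreal C * bergman_mass \<beta> q (u n)" for n
  proof -
    let ?a = "a (r n)" and ?d = "d (r n)"
    have "c * ?d powr (- ((2 + \<beta>) / q)) = ?d powr (- ((2 + \<alpha>) / p)) * (c * ?d powr ?\<gamma>)"
      by (simp flip: powr_add)
    also have "\<dots> \<le> norm (u n ?a)"
      unfolding u_def t_def norm_mult norm_test_function_centre[OF a(2) pq(1)] d_def
      by (intro mult_left_mono less_imp_le[OF a(3)]) auto
    finally have "(c * ?d powr (- ((2 + \<beta>) / q))) powr q \<le> norm (u n ?a) powr q"
      using c q by (intro powr_mono2) auto
    moreover have "(c * ?d powr (- ((2 + \<beta>) / q))) powr q = c powr q * ?d powr (- (\<beta> + 2))"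
      using c q by (simp add: powr_mult powr_powr add.commute)
    ultimately have "c powr q * ?d powr (- (\<beta> + 2)) * ?d powr (\<beta> + 2) \<le>
        norm (u n ?a) powr q * ?d powr (\<beta> + 2)"
      by (intro mult_right_mono) auto
    then have "c powr q \<le> norm (u n ?a) powr q * ?d powr (\<beta> + 2)"
      using d[of "r n"] unfolding mult.assoc powr_add[symmetric] by simp
    then have "ennreal (c powr q) \<le> ennreal (norm (u n ?a) powr q * ?d powr (\<beta> + 2))"
      by (rule ennreal_leI)
    also have "\<dots> \<le> ennreal C * bergman_mass \<beta> q (u n)"
      unfolding d_def using a(2) by (intro C(2) uhol) auto
    finally show ?thesis .
  qed
  have "ennreal (c powr q) \<le> 0"
    using limC' low by (intro tendsto_lowerbound[OF limC']) auto
  then show False using c by (simp add: ennreal_eq_0_iff)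
qed

theorem theorem7:
  fixes \<alpha> \<beta> p q :: real and g :: "complex \<Rightarrow> complex"
  assumes "\<alpha> > -1" and "\<beta> > -1"
    and "g holomorphic_on unit_disk"
    and "0 < p" and "p < q"
  shows "dirichlet_compact_operator \<alpha> p \<beta> q (S_op g) \<longleftrightarrow>
    (\<lambda>z. norm (g z)) \<in> o[filtercomap norm (at_left 1)](\<lambda>z.
      (1 - (norm z)\<^sup>2) powr ((2 + \<alpha>) / p - (2 + \<beta>) / q))"
  unfolding smallo_unit_disk_iff
  using S_op_compact_if_smallo[OF assms(2-5)] smallo_if_S_op_compact[OF assms(1,3-5)] by blast

end
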